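(* Let $\mathcal H_{\rm word}$ be the class of word-representable graphs. Then for every $p\in[0,1]$, $$\mathrm{ed}_{\mathcal H_{\rm word}}(p)=\min\{p/3,\;1-p\}.$$ Consequently $\max\{\mathrm{dist}(G,\mathcal H_{\rm word}) : |V(G)|=n\}=\tfrac14-o(1)$ as $n\to\infty$ (equivalently, the maximum over $n$-vertex graphs $G$ of the minimum number of edge additions/deletions needed to make $G$ word-representable is $\tfrac14\binom n2-o(n^2)$). Moreover, for every $\epsilon>0$ and every graph $G$ on $n\ge 2$ vertices, if $\mathrm{dist}(G,\mathcal H_{\rm word})\ge \tfrac14-\epsilon$, then $|E(G)|/\binom n2\in[\tfrac34-3\epsilon,\tfrac34+\epsilon]$.
   Context: A word over an alphabet $V$ represents a graph $G=(V,E)$ if for all distinct $x,y\in V$: $xy\in E$ if and only if the occurrences of $x$ and $y$ alternate in the word. $G$ is word-representable if some word represents it; $\mathcal H_{\rm word}$ denotes the class of word-representable graphs (a hereditary property: closed under isomorphism and taking induced subgraphs). For graphs $G,H$ on the same $n$-vertex set, $\mathrm{dist}(G,H)=|E(G)\triangle E(H)|/\binom n2$. For a hereditary property $\mathcal H$, $\mathrm{dist}(G,\mathcal H)=\min\{\mathrm{dist}(G,H): H\in\mathcal H,\ V(H)=V(G)\}$. The edit distance function is $\mathrm{ed}_{\mathcal H}(p)=\lim_{n\to\infty}\max\{\mathrm{dist}(G,\mathcal H): |V(G)|=n,\ |E(G)|=\lfloor p\binom n2\rfloor\}$ (this limit exists for every hereditary property). *)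

theory Defs
  imports Complex_Main
begin

text \<open>Simple graphs: a finite vertex set V and an edge set E of 2-element subsets of V.\<close>

definition all_pairs :: "'a set \<Rightarrow> 'a set set" where
  "all_pairs V = {e. \<exists>x y. x \<in> V \<and> y \<in> V \<and> x \<noteq> y \<and> e = {x, y}}"

definition alternate :: "'a list \<Rightarrow> 'a \<Rightarrow> 'a \<Rightarrow> bool" where
  "alternate w x y =
     (let u = filter (\<lambda>z. z = x \<or> z = y) w
      in \<forall>i. Suc i < length u \<longrightarrow> u ! i \<noteq> u ! Suc i)"

definition represents :: "'a list \<Rightarrow> 'a set \<Rightarrow> 'a set set \<Rightarrow> bool" where
  "represents w V E =
     (set w = V \<and> (\<forall>x\<in>V. \<forall>y\<in>V. x \<noteq> y \<longrightarrow> ({x, y} \<in> E \<longleftrightarrow> alternate w x y)))"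

definition word_representable :: "'a set \<Rightarrow> 'a set set \<Rightarrow> bool" where
  "word_representable V E = (\<exists>w. represents w V E)"

definition gdist :: "'a set \<Rightarrow> 'a set set \<Rightarrow> 'a set set \<Rightarrow> real" where
  "gdist V E E' = real (card (E - E' \<union> (E' - E))) / real (card V choose 2)"

definition dist_word :: "'a set \<Rightarrow> 'a set set \<Rightarrow> real" where
  "dist_word V E =
     Min {gdist V E E' | E'. E' \<subseteq> all_pairs V \<and> word_representable V E'}"

text \<open>Maximum distance over n-vertex graphs with exactly floor(p * (n choose 2)) edges
  (vertex set {0..<n}; the class is isomorphism invariant).\<close>

definition ed_max :: "real \<Rightarrow> nat \<Rightarrow> real" where
  "ed_max p n =
     Max {dist_word {..<n} E | E. E \<subseteq> all_pairs {..<n} \<and>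
            card E = nat \<lfloor>p * real (n choose 2)\<rfloor>}"

definition dist_max :: "nat \<Rightarrow> real" where
  "dist_max n = Max {dist_word {..<n} E | E. E \<subseteq> all_pairs {..<n}}"

end

theory Submission
  imports Defs "HOL-Analysis.Convex"
begin

text \<open>
  Upper bound: every 3-colourable graph is word-representable, and a best 3-colouring leaves at most a
  third of the edges monochromatic, so deleting those costs at most \<open>p / 3\<close>; completing the graph
  costs \<open>1 - p\<close>.

  Lower bound: order the vertices of a word-representable graph \<open>H\<close> by first occurrence. Comparing
  letter counts in prefixes shows that \<open>ab, bc, cd, ad \<in> H\<close> with \<open>a < b < c < d\<close> forces
  \<open>ac, bd \<in> H\<close>. Let \<open>G\<close> be quasirandom of density \<open>p\<close>. Cut the ordering into \<open>k\<close> intervals and shrink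
  them to subsets, still of linear size, between which \<open>H\<close> is regular. Call a pair white, black or gray
  if the density of \<open>H\<close> on it is near 0, near 1 or neither. By the forcing rule, the diagonals of a
  monotone 4-cycle of non-white pairs are black, so a vertex has gray degree at most 2 into a clique of
  non-white pairs. Peeling off maximal such cliques yields (gray) \<open>\<le>\<close> 2 (white) + \<open>k\<close>. As white pairs
  cost \<open>p\<close> and black pairs cost \<open>1 - p\<close>, the distance is at least \<open>min (p / 3) (1 - p) - o(1)\<close>.
\<close>

section \<open>Words representing 3-colourable graphs\<close>

text \<open>Two obstacles shape the lower bound. The ordering comes from \<open>H\<close>, which is
  chosen after \<open>G\<close>; so \<open>G\<close> has to look random on all pairs of linear-sized
  sets at once, and a single number, the box norm, controls all of them. Moreover the forcing rule
  is applied to cliques of unknown shape, so every pair of parts must be regular, without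
  exceptional pairs, and the parts must stay ordered. Subsets of the intervals keep the order, but
  the edits might concentrate on them, and then a lower bound on the subsets would say nothing about
  the intervals; this is why the edit cost enters the potential that is minimised. The weight 2 of
  white pairs matches the 3 in \<open>p / 3\<close>: a white pair costs at least three times the
  target, so it pays for itself and for two gray pairs, which may be free. The error left over is
  linear in \<open>k\<close>, against about \<open>k^2 / 2\<close> pairs.\<close>

lemma alternate_iff_distinct_adj:
  "alternate w x y \<longleftrightarrow> distinct_adj (filter (\<lambda>z. z = x \<or> z = y) w)"
  unfolding alternate_def Let_def distinct_adj_conv_nth
  by (metis Suc_lessE Suc_lessI diff_Suc_1 less_diff_conv Suc_eq_plus1)

lemma alternate_commute: "alternate w x y \<longleftrightarrow> alternate w y x"
  by (simp add: alternate_def disj_commute)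

lemma alternate_infix: "alternate (u @ v @ w) x y \<Longrightarrow> alternate v x y"
  by (auto simp: alternate_iff_distinct_adj distinct_adj_append_iff)

lemma alternate_repeat:
  assumes "x \<noteq> y" "filter (\<lambda>z. z = x \<or> z = y) w = concat (replicate k [x, y])"
  shows "alternate w x y"
proof -
  have "distinct_adj (concat (replicate k [x, y])) \<and> (k > 0 \<longrightarrow> hd (concat (replicate k [x, y])) = x)" for k
    using assms(1) by (induction k) (auto simp: distinct_adj_Cons)
  then show ?thesis using assms(2) by (simp add: alternate_iff_distinct_adj)
qed

lemma filter_pair_distinct:
  assumes "distinct xs"
  shows "x \<in> set xs \<Longrightarrow> y \<notin> set xs \<Longrightarrow> filter (\<lambda>z. z = x \<or> z = y) xs = [x]"
    and "x \<notin> set xs \<Longrightarrow> y \<in> set xs \<Longrightarrow> filter (\<lambda>z. z = x \<or> z = y) xs = [y]"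
    and "x \<notin> set xs \<Longrightarrow> y \<notin> set xs \<Longrightarrow> filter (\<lambda>z. z = x \<or> z = y) xs = []"
proof -
  have *: "filter (\<lambda>z. z = a) xs = (if a \<in> set xs then [a] else [])" for a
    using assms by (induction xs) (auto simp: filter_empty_conv)
  have "x \<notin> set xs \<Longrightarrow> filter (\<lambda>z. z = x \<or> z = y) xs = filter (\<lambda>z. z = y) xs"
    "y \<notin> set xs \<Longrightarrow> filter (\<lambda>z. z = x \<or> z = y) xs = filter (\<lambda>z. z = x) xs"
    by (auto intro!: filter_cong)
  with * show "x \<in> set xs \<Longrightarrow> y \<notin> set xs \<Longrightarrow> filter (\<lambda>z. z = x \<or> z = y) xs = [x]"
    "x \<notin> set xs \<Longrightarrow> y \<in> set xs \<Longrightarrow> filter (\<lambda>z. z = x \<or> z = y) xs = [y]"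
    "x \<notin> set xs \<Longrightarrow> y \<notin> set xs \<Longrightarrow> filter (\<lambda>z. z = x \<or> z = y) xs = []"
    by auto
qed

text \<open>Alternation can break at the seam of a concatenation. Requiring the lower colour to
  start and the higher one to end makes the property closed under concatenation; the exponent
  \<open>k\<close> may differ from pair to pair.\<close>

definition round_word :: "'a set set \<Rightarrow> ('a \<Rightarrow> nat) \<Rightarrow> 'a list \<Rightarrow> bool" where
  "round_word E col u \<longleftrightarrow>
     (\<forall>x y. {x, y} \<in> E \<longrightarrow> col x < col y \<longrightarrow>
        (\<exists>k. filter (\<lambda>z. z = x \<or> z = y) u = concat (replicate k [x, y])))"

lemma round_word_Nil: "round_word E col []"
  by (auto simp: round_word_def intro: exI[of _ 0])

lemma round_word_append:
  assumes "round_word E col u" "round_word E col v"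
  shows "round_word E col (u @ v)"
  unfolding round_word_def
proof (intro allI impI)
  fix x y assume "{x, y} \<in> E" "col x < col y"
  with assms obtain k l where
    "filter (\<lambda>z. z = x \<or> z = y) u = concat (replicate k [x, y])"
    "filter (\<lambda>z. z = x \<or> z = y) v = concat (replicate l [x, y])"
    unfolding round_word_def by blast
  then show "\<exists>k. filter (\<lambda>z. z = x \<or> z = y) (u @ v) = concat (replicate k [x, y])"
    by (intro exI[of _ "k + l"]) (simp add: replicate_add)
qed

lemma round_word_concat:
  "(\<And>u. u \<in> set us \<Longrightarrow> round_word E col u) \<Longrightarrow> round_word E col (concat us)"
  by (induction us) (auto intro: round_word_append round_word_Nil)

text \<open>If \<open>x\<close> and \<open>y\<close> have colours 0 and 2, a path through colour 1 may force \<open>x\<close> before \<open>y\<close> in every round.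
  Their alternation is then broken by postponing \<open>y\<close> into the next round, past its colour-0 non-neighbours.\<close>

lemma round_word_separating:
  assumes E: "E \<subseteq> all_pairs V" and fin: "finite V"
    and proper: "\<And>x y. {x, y} \<in> E \<Longrightarrow> col x \<noteq> col y"
    and col: "\<And>x. x \<in> V \<Longrightarrow> col x < (3::nat)"
    and xy: "x \<in> V" "y \<in> V" "x \<noteq> y" "{x, y} \<notin> E" "col x \<le> col y"
  shows "\<exists>u. set u = V \<and> round_word E col u \<and> \<not> alternate u x y"
proof -
  obtain vs where vs: "set vs = V" "distinct vs"
    using finite_distinct_list[OF fin] by blast
  define L where "L r = filter (\<lambda>z. col z = r) vs" for r
  define N where "N v = (\<lambda>z. {z, v} \<in> E)" for v
  define R where "R = L 0 @ L 1 @ L 2"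
  note fp = filter_pair_distinct
  have fpi: "filter (\<lambda>z. z = a \<or> z = b) xs = (if a \<in> set xs then [a] else if b \<in> set xs then [b] else [])"
    if "distinct xs" "\<not> (a \<in> set xs \<and> b \<in> set xs)" for xs and a b :: 'a
    using that fp[of xs a b] by auto
  have V: "{a, b} \<in> E \<Longrightarrow> a \<in> V \<and> b \<in> V \<and> a \<noteq> b" for a b
    using E by (auto simp: all_pairs_def doubleton_eq_iff)
  have dL: "distinct (L r)" "distinct (filter P (L r))" "distinct (rev (L r))" "distinct (removeAll v (L r))" for r P v
    using vs(2) by (auto simp: L_def distinct_removeAll)
  have sL: "set (L r) = {z \<in> V. col z = r}" for r
    using vs(1) by (auto simp: L_def)
  have lt3: "a \<in> V \<Longrightarrow> col a = 0 \<or> col a = 1 \<or> col a = 2" for a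
    using col[of a] by linarith
  have rR: "set R = V" by (auto simp: R_def sL dest: lt3)
  have edge: "col a = 0 \<and> col b = 1 \<or> col a = 0 \<and> col b = 2 \<or> col a = 1 \<and> col b = 2"
    if "{a, b} \<in> E" "col a < col b" for a b
    using V[OF that(1)] lt3[of a] lt3[of b] that(2) by auto
  have roundI: "round_word E col u"
    if "\<And>a b. {a, b} \<in> E \<Longrightarrow> a \<in> V \<Longrightarrow> b \<in> V \<Longrightarrow> a \<noteq> b \<Longrightarrow> col a = 0 \<and> col b = 1 \<or> col a = 0 \<and> col b = 2 \<or> col a = 1 \<and> col b = 2
         \<Longrightarrow> filter (\<lambda>z. z = a \<or> z = b) u = concat (replicate k [a, b])" for u k
    unfolding round_word_def using that V edge by blast
  have two: "concat (replicate 2 [a, b]) = [a, b, a, b]" for a b :: 'a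
    by (simp add: numeral_2_eq_2)
  have one: "concat (replicate 1 [a, b]) = [a, b]" for a b :: 'a
    by simp
  have rdR: "round_word E col R"
    by (rule roundI[of _ 1]) (auto simp: R_def sL fp dL)
  have na: "\<not> alternate u x y"
    if "filter (\<lambda>z. z = x \<or> z = y) u \<in> {[x,y,y,x], [y,x,x,y], [x,x,y,y]}" for u
    using that by (auto simp: alternate_iff_distinct_adj)
  consider (same) r where "col x = r" "col y = r" | (c01) "col x = 0" "col y = 1" | (c02) "col x = 0" "col y = 2"
    | (c12) "col x = 1" "col y = 2"
    using lt3[of x] lt3[of y] xy by fastforce
  then show ?thesis
  proof cases
    case (same r)
    \<comment> \<open>Reversing each colour class keeps the order of the colours but mirrors a pair
      inside one class, so equal letters meet at the seam.\<close>
    let ?Q = "rev (L 0) @ rev (L 1) @ rev (L 2)"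
    have rd: "round_word E col (R @ ?Q)"
      by (rule round_word_append[OF rdR], rule roundI[of _ 1]) (auto simp: sL fp dL)
    have 1: "filter (\<lambda>z. z = x \<or> z = y) R = filter (\<lambda>z. z = x \<or> z = y) (L r)"
      using lt3[of x] same xy by (auto simp: R_def sL fp dL)
    have 2: "filter (\<lambda>z. z = x \<or> z = y) ?Q = rev (filter (\<lambda>z. z = x \<or> z = y) (L r))"
      using lt3[of x] same xy by (auto simp: sL fp dL rev_filter)
    have "filter (\<lambda>z. z = x \<or> z = y) (L r) \<noteq> []"
      using same xy by (auto simp: filter_empty_conv sL)
    then have "\<not> alternate (R @ ?Q) x y"
      unfolding alternate_iff_distinct_adj filter_append[of _ R "?Q"] 1 2
      by (simp add: distinct_adj_append_iff hd_rev)
    with rd rR show ?thesis by (intro exI[of _ "R @ ?Q"]) (auto simp: sL dest: lt3)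
  next
    case c01
    \<comment> \<open>Right after its colour-0 neighbours \<open>y\<close> may jump ahead of the
      other colour-0 letters, \<open>x\<close> among them: the pair reads \<open>xy\<close> in
      \<open>R\<close> and \<open>yx\<close> here.\<close>
    let ?F = "filter (N y) (L 0) @ [y] @ filter (\<lambda>z. \<not> N y z) (L 0) @ removeAll y (L 1) @ L 2"
    have rd: "round_word E col (R @ ?F)"
    proof (rule round_word_append[OF rdR], rule roundI[of _ 1], goal_cases)
      case (1 a b)
      show ?case using 1(5)
        by (elim disjE conjE; cases "b = y"; cases "a = y"; cases "N y a"; cases "N y b")
          (use 1(1-4) c01 xy in \<open>simp_all add: sL dL fpi N_def two del: filter_filter\<close>)
    qed
    have "filter (\<lambda>z. z = x \<or> z = y) (R @ ?F) = [x,y,y,x]"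
      using c01 xy by (simp add: R_def sL dL fpi N_def del: filter_filter)
    moreover have "set (R @ ?F) = V" using c01 xy rR by (auto simp: sL)
    ultimately show ?thesis using na rd by blast
  next
    case c12
    let ?F = "L 0 @ filter (N y) (L 1) @ [y] @ filter (\<lambda>z. \<not> N y z) (L 1) @ removeAll y (L 2)"
    have rd: "round_word E col (R @ ?F)"
    proof (rule round_word_append[OF rdR], rule roundI[of _ 1], goal_cases)
      case (1 a b)
      show ?case using 1(5)
        by (elim disjE conjE; cases "b = y"; cases "a = y"; cases "N y a"; cases "N y b")
          (use 1(1-4) c12 xy in \<open>simp_all add: sL dL fpi N_def two del: filter_filter\<close>)
    qed
    have "filter (\<lambda>z. z = x \<or> z = y) (R @ ?F) = [x,y,y,x]"
      using c12 xy by (simp add: R_def sL dL fpi N_def del: filter_filter)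
    moreover have "set (R @ ?F) = V" using c12 xy rR by (auto simp: sL)
    ultimately show ?thesis using na rd by blast
  next
    case c02
    \<comment> \<open>Two overlapping rounds, hence the exponent 2 below. The \<open>y\<close> due
      in the first round waits until its colour-0 non-neighbours have occurred twice; any neighbour
      \<open>a\<close> of \<open>y\<close> with a lower colour still sees
      \<open>ayay\<close>.\<close>
    let ?F = "L 0 @ L 1 @ removeAll y (L 2) @ filter (\<lambda>z. \<not> N y z) (L 0) @ [y] @ filter (N y) (L 0) @ L 1 @ L 2"
    have rd: "round_word E col ?F"
    proof (rule roundI[of _ 2], goal_cases)
      case (1 a b)
      show ?case using 1(5)
        by (elim disjE conjE; cases "b = y"; cases "a = y"; cases "N y a"; cases "N y b")
          (use 1(1-4) c02 xy in \<open>simp_all add: sL dL fpi N_def two del: filter_filter\<close>)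
    qed
    have "filter (\<lambda>z. z = x \<or> z = y) ?F = [x,x,y,y]"
      using c02 xy by (simp add: R_def sL dL fpi N_def del: filter_filter)
    moreover have "set ?F = V" using c02 xy by (auto simp: sL dest: lt3)
    ultimately show ?thesis using na rd by blast
  qed
qed

text \<open>One separating block per non-edge is concatenated. Edges survive because all blocks are
  round words; a non-edge fails inside its own block, and alternation would pass to infixes. The
  leading \<open>R\<close> makes every vertex occur even if there are no non-edges.\<close>

lemma word_representable_three_colourable:
  assumes E: "E \<subseteq> all_pairs V" and fin: "finite V"
    and proper: "\<And>x y. {x, y} \<in> E \<Longrightarrow> col x \<noteq> col y"
    and col: "\<And>x. x \<in> V \<Longrightarrow> col x < (3::nat)"
  shows "word_representable V E"
proof -
  define NE where "NE = {(x, y). x \<in> V \<and> y \<in> V \<and> x \<noteq> y \<and> {x, y} \<notin> E}"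
  have "\<exists>u. set u = V \<and> round_word E col u \<and> \<not> alternate u (fst q) (snd q)" if "q \<in> NE" for q
  proof -
    obtain x y where q: "q = (x, y)" by force
    show ?thesis
    proof (cases "col x \<le> col y")
      case True
      then show ?thesis using round_word_separating[of E V col x y] assms that q by (auto simp: NE_def)
    next
      case False
      then show ?thesis using round_word_separating[of E V col y x] assms that q
        by (auto simp: NE_def insert_commute alternate_commute)
    qed
  qed
  then obtain U where U: "\<And>q. q \<in> NE \<Longrightarrow> set (U q) = V \<and> round_word E col (U q) \<and> \<not> alternate (U q) (fst q) (snd q)"
    by metis
  have "finite NE" by (rule finite_subset[of _ "V \<times> V"]) (use fin in \<open>auto simp: NE_def\<close>)
  then obtain qs where qs: "set qs = NE" using finite_list by blast
  obtain vs where vs: "set vs = V" "distinct vs"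
    using finite_distinct_list[OF fin] by blast
  define R where "R = filter (\<lambda>z. col z = 0) vs @ filter (\<lambda>z. col z = 1) vs @ filter (\<lambda>z. col z = 2) vs"
  have lt3: "a \<in> V \<Longrightarrow> col a = 0 \<or> col a = 1 \<or> col a = 2" for a
    using col[of a] by linarith
  have "filter (\<lambda>z. z = x \<or> z = y) R = concat (replicate 1 [x, y])"
    if "{x, y} \<in> E" "col x < col y" for x y
  proof -
    have "x \<in> V" "y \<in> V" "x \<noteq> y" using E that by (auto simp: all_pairs_def doubleton_eq_iff)
    then show ?thesis
      using lt3[of x] lt3[of y] that(2) vs by (auto simp: R_def filter_pair_distinct simp del: filter_filter)
  qed
  then have rR: "round_word E col R"
    unfolding round_word_def by blast
  have sR: "set R = V" by (auto simp: R_def vs dest: lt3)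
  define w where "w = R @ concat (map U qs)"
  have sw: "set w = V" using U qs sR by (auto simp: w_def)
  have rw: "round_word E col w"
    unfolding w_def using U qs by (intro round_word_append rR round_word_concat) auto
  have "{x, y} \<in> E \<longleftrightarrow> alternate w x y" if "x \<in> V" "y \<in> V" "x \<noteq> y" for x y
  proof
    assume e: "{x, y} \<in> E"
    have alt: "alternate w a b" if "{a, b} \<in> E" "col a < col b" for a b
      using rw that alternate_repeat[of a b w] unfolding round_word_def by fastforce
    consider "col x < col y" | "col y < col x" using proper[OF e] by linarith
    then show "alternate w x y"
      using alt[of x y] alt[of y x] e alternate_commute[of w x y] by cases (simp_all add: insert_commute)
  next
    assume a: "alternate w x y"
    show "{x, y} \<in> E"
    proof (rule ccontr)
      assume "{x, y} \<notin> E"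
      then have q: "(x, y) \<in> NE" using that by (auto simp: NE_def)
      then obtain l r where "qs = l @ (x, y) # r" using qs by (metis split_list)
      then have "w = (R @ concat (map U l)) @ U (x, y) @ concat (map U r)" by (simp add: w_def)
      then show False using a alternate_infix U[OF q] by (metis fst_conv snd_conv)
    qed
  qed
  then show ?thesis unfolding word_representable_def represents_def using sw by blast
qed

lemma word_representable_complete:
  assumes "finite V"
  shows "word_representable V (all_pairs V)"
proof -
  obtain vs where vs: "set vs = V" "distinct vs"
    using finite_distinct_list[OF assms] by blast
  have "distinct_adj (filter P vs)" for P
    using vs(2) by (simp add: distinct_adj_conv_nth nth_eq_iff_index_eq less_diff_conv)
  then show ?thesis
    unfolding word_representable_def represents_def alternate_iff_distinct_adj all_pairs_def
    using vs by blast
qed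

section \<open>The vertex ordering of a word-representable graph\<close>

text \<open>Inequalities between counts can be chained, which alternation cannot. The induction
  generalises over \<open>x\<close> and \<open>y\<close> because reading the letter \<open>x\<close>
  swaps their roles: the rest of the word must then satisfy the condition with \<open>y\<close>
  leading.\<close>

lemma prefix_counts_iff:
  assumes "x \<noteq> y"
  shows "(\<forall>m. count_list (take m w) y \<le> count_list (take m w) x \<and>
              count_list (take m w) x \<le> count_list (take m w) y + 1) \<longleftrightarrow>
         alternate w x y \<and> (let u = filter (\<lambda>z. z = x \<or> z = y) w in u = [] \<or> hd u = x)"
  using assms
proof (induction w arbitrary: x y)
  case Nil
  then show ?case by (simp add: alternate_iff_distinct_adj)
next
  case (Cons z w)
  let ?P = "\<lambda>w x y m. count_list (take m w) y \<le> count_list (take m w) x \<and>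
              count_list (take m w) x \<le> count_list (take m w) y + 1"
  have *: "(\<forall>m. ?P (z # w) x y m) \<longleftrightarrow> (\<forall>m. ?P (z # w) x y (Suc m))"
    by (metis not0_implies_Suc take_0 count_list.simps(1) le0)
  have hd: "u \<noteq> [] \<Longrightarrow> hd u \<in> {x, y}" if "u = filter (\<lambda>z. z = x \<or> z = y) w" for u
    using that hd_in_set[of u] by auto
  have sw: "filter (\<lambda>z. z = y \<or> z = x) w = filter (\<lambda>z. z = x \<or> z = y) w"
    by (intro filter_cong) auto
  consider "z = x" | "z = y" | "z \<noteq> x" "z \<noteq> y" by blast
  then show ?case
  proof cases
    case 1
    have "(\<forall>m. ?P (z # w) x y m) \<longleftrightarrow> (\<forall>m. ?P w y x m)"
      unfolding * using 1 Cons.prems by auto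
    also have "\<dots> \<longleftrightarrow> alternate w y x \<and> (let u = filter (\<lambda>z. z = y \<or> z = x) w in u = [] \<or> hd u = y)"
      using Cons.IH[of y x] Cons.prems by simp
    finally show ?thesis
      using 1 Cons.prems hd[OF refl] by (auto simp: alternate_iff_distinct_adj distinct_adj_Cons sw Let_def)
  next
    case 2
    have "\<not> (\<forall>m. ?P (z # w) x y m)"
      unfolding * using 2 Cons.prems by (auto intro!: exI[of _ 0])
    with 2 Cons.prems show ?thesis by simp
  next
    case 3
    have "(\<forall>m. ?P (z # w) x y m) \<longleftrightarrow> (\<forall>m. ?P w x y m)"
      unfolding * using 3 by auto
    with 3 Cons show ?thesis by (simp add: alternate_iff_distinct_adj)
  qed
qed

text \<open>\<open>pos\<close> is the first occurrence. On each prefix of the word the letter counts satisfy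
  \<open>a \<ge> b \<ge> c \<ge> d \<ge> a - 1\<close>, so all six pairs alternate.\<close>

lemma word_representable_ordering:
  assumes "word_representable V E"
  obtains pos :: "'a \<Rightarrow> nat" where "inj_on pos V"
    "\<forall>a\<in>V. \<forall>b\<in>V. \<forall>c\<in>V. \<forall>d\<in>V. pos a < pos b \<longrightarrow> pos b < pos c \<longrightarrow> pos c < pos d \<longrightarrow>
       {a, b} \<in> E \<longrightarrow> {b, c} \<in> E \<longrightarrow> {c, d} \<in> E \<longrightarrow> {a, d} \<in> E \<longrightarrow> {a, c} \<in> E \<and> {b, d} \<in> E"
proof -
  obtain w where sw: "set w = V"
    and w: "\<And>x y. x \<in> V \<Longrightarrow> y \<in> V \<Longrightarrow> x \<noteq> y \<Longrightarrow> {x, y} \<in> E \<longleftrightarrow> alternate w x y"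
    using assms unfolding word_representable_def represents_def by blast
  define pos where "pos x = length (takeWhile (\<lambda>z. z \<noteq> x) w)" for x
  have lt: "pos x < length w" "w ! pos x = x" if "x \<in> V" for x
  proof -
    have "takeWhile (\<lambda>z. z \<noteq> x) w \<noteq> w"
      using that sw by (auto simp: takeWhile_eq_all_conv)
    then have "pos x \<noteq> length w"
      unfolding pos_def by (metis takeWhile_eq_take take_all order_refl)
    then show l: "pos x < length w"
      using length_takeWhile_le[of "\<lambda>z. z \<noteq> x" w] by (simp add: pos_def)
    show "w ! pos x = x" using nth_length_takeWhile[of "\<lambda>z. z \<noteq> x" w] l by (simp add: pos_def)
  qed
  have inj: "inj_on pos V" by (metis inj_onI lt(2))
  define le where "le x y \<longleftrightarrow> (\<forall>m. count_list (take m w) y \<le> count_list (take m w) x \<and>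
              count_list (take m w) x \<le> count_list (take m w) y + 1)" for x y
  have le_imp: "{x, y} \<in> E" if "le x y" "x \<in> V" "y \<in> V" "x \<noteq> y" for x y
    using that w prefix_counts_iff[of x y w] unfolding le_def by blast
  \<comment> \<open>An alternating pair satisfies \<open>le\<close> in one direction, determined by
    its first letter. The prefix ending at the first \<open>x\<close> contains no \<open>y\<close>,
    which excludes \<open>le y x\<close>.\<close>
  have imp_le: "le x y" if "{x, y} \<in> E" "x \<in> V" "y \<in> V" "pos x < pos y" for x y
  proof -
    have ne: "x \<noteq> y" using that by auto
    have "take (Suc (pos x)) w = take (pos x) w @ [x]"
      using lt[OF that(2)] by (simp add: take_Suc_conv_app_nth)
    then have cx: "count_list (take (Suc (pos x)) w) x \<ge> 1" by simp
    have "set (take (Suc (pos x)) w) \<subseteq> set (take (pos y) w)"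
      using that(4) by (intro set_take_subset_set_take) simp
    also have "take (pos y) w = takeWhile (\<lambda>z. z \<noteq> y) w"
      unfolding pos_def by (metis takeWhile_eq_take)
    finally have "y \<notin> set (take (Suc (pos x)) w)" by (auto dest: set_takeWhileD)
    then have "count_list (take (Suc (pos x)) w) y = 0" by (simp add: count_list_0_iff)
    with cx have "\<not> count_list (take (Suc (pos x)) w) x \<le> count_list (take (Suc (pos x)) w) y"
      by linarith
    then have nle: "\<not> le y x" unfolding le_def by blast
    have alt: "alternate w x y" using w that ne by blast
    define u where "u = filter (\<lambda>z. z = x \<or> z = y) w"
    have u: "u = [] \<or> hd u = x \<or> hd u = y"
      using hd_in_set[of u] by (auto simp: u_def)
    have u': "filter (\<lambda>z. z = y \<or> z = x) w = u"
      unfolding u_def by (intro filter_cong) auto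
    have "le y x \<longleftrightarrow> alternate w y x \<and> (u = [] \<or> hd u = y)"
      unfolding le_def prefix_counts_iff[OF ne[symmetric]] Let_def u' ..
    then have "\<not> (u = [] \<or> hd u = y)"
      using nle alt alternate_commute[of w x y] by blast
    with u have "u = [] \<or> hd u = x" by blast
    then show ?thesis
      unfolding le_def prefix_counts_iff[OF ne] Let_def using alt by (simp add: u_def)
  qed
  show thesis
  proof (rule that[OF inj], intro ballI impI, goal_cases)
    case (1 a b c d)
    then have l: "le a b" "le b c" "le c d" "le a d" and ne: "a \<noteq> c" "b \<noteq> d"
      using imp_le by auto
    have "le a c \<and> le b d" unfolding le_def
    proof (intro conjI allI, goal_cases)
      case (1 m) with l show ?case unfolding le_def using order_trans by blast
    next
      case (2 m) 
      have "count_list (take m w) a \<le> count_list (take m w) d + 1"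
        "count_list (take m w) d \<le> count_list (take m w) c" using l unfolding le_def by auto
      then show ?case by linarith
    next
      case (3 m) with l show ?case unfolding le_def using order_trans by blast
    next
      case (4 m)
      have "count_list (take m w) a \<le> count_list (take m w) d + 1"
        "count_list (take m w) b \<le> count_list (take m w) a" using l unfolding le_def by auto
      then show ?case by linarith
    qed
    with le_imp 1 ne show ?case by blast
  qed
qed

section \<open>White, gray and black pairs\<close>

lemma three_elements_sorted:
  fixes C :: "nat set"
  assumes "finite C" "2 < card C"
  obtains a b c where "a \<in> C" "b \<in> C" "c \<in> C" "a < b" "b < c"
proof -
  have ne: "C \<noteq> {}" using assms by auto
  have "card (C - {Min C, Max C}) > 0"
    using assms diff_card_le_card_Diff[of "{Min C, Max C}" C] card_insert_le_m1[of 2 "{Max C}" "Min C"] by simp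
  then obtain b where b: "b \<in> C" "b \<noteq> Min C" "b \<noteq> Max C"
    by (metis Diff_iff card_gt_0_iff ex_in_conv insertCI)
  with ne assms have "Min C < b" "b < Max C"
    by (metis Min_le order_le_less, metis Max_ge order_le_less)
  with b ne assms that show thesis by (meson Max_in Min_in)
qed

text \<open>Here \<open>S\<close> means non-white. Let \<open>T\<close> be a maximal clique of
  \<open>S\<close>. A vertex inside \<open>T\<close> sees at most two gray pairs in
  \<open>T\<close>; a vertex outside sees a white one by maximality, whose -2 cancels its at most
  two gray ones. So \<open>T\<close> contributes at most \<open>2 * card T\<close>, and the rest is
  handled by induction. The double sum counts each unordered pair twice.\<close>

lemma gray_le_twice_white:
  fixes S Gr :: "nat \<Rightarrow> nat \<Rightarrow> bool" and V :: "nat set"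
  defines "\<phi> \<equiv> \<lambda>i j. if i = j then 0 else of_bool (Gr i j) - 2 * of_bool (\<not> S i j) :: real"
  assumes fin: "finite V"
    and S: "\<And>i j. S i j \<longleftrightarrow> S j i" and Gr: "\<And>i j. Gr i j \<longleftrightarrow> Gr j i" and GS: "\<And>i j. Gr i j \<Longrightarrow> S i j"
    and diag: "\<And>i j k l. {i, j, k, l} \<subseteq> V \<Longrightarrow> i < j \<Longrightarrow> j < k \<Longrightarrow> k < l \<Longrightarrow>
        S i j \<Longrightarrow> S j k \<Longrightarrow> S k l \<Longrightarrow> S i l \<Longrightarrow> \<not> Gr i k \<and> \<not> Gr j l"
  shows "(\<Sum>i\<in>V. \<Sum>j\<in>V. \<phi> i j) \<le> 2 * real (card V)"
  using fin diag
proof (induction V rule: finite_psubset_induct)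
  case (psubset V)
  show ?case
  proof (cases "V = {}")
    case False
    then obtain v where "v \<in> V" by blast
    define Q where "Q = {T. T \<subseteq> V \<and> (\<forall>i\<in>T. \<forall>j\<in>T. i \<noteq> j \<longrightarrow> S i j)}"
    have "finite Q" by (rule finite_subset[of _ "Pow V"]) (use psubset.hyps in \<open>auto simp: Q_def\<close>)
    moreover have "{v} \<in> Q" using \<open>v \<in> V\<close> by (auto simp: Q_def)
    ultimately obtain T where T: "T \<in> Q" "{v} \<subseteq> T" and max: "\<And>T'. T' \<in> Q \<Longrightarrow> T \<subseteq> T' \<Longrightarrow> T = T'"
      using finite_has_maximal2[of Q "{v}"] by blast
    have TV: "T \<subseteq> V" and cl: "\<And>i j. i \<in> T \<Longrightarrow> j \<in> T \<Longrightarrow> i \<noteq> j \<Longrightarrow> S i j" using T by (auto simp: Q_def)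
    have finT: "finite T" using TV psubset.hyps finite_subset by blast
    have deg: "card {c \<in> T - {u}. Gr u c} \<le> 2" if u: "u \<in> V" and C: "\<And>c. c \<in> T - {u} \<Longrightarrow> Gr u c \<Longrightarrow> S u c" for u
    proof (rule ccontr)
      assume "\<not> ?thesis"
      then have "2 < card {c \<in> T - {u}. Gr u c}" by simp
      then obtain a b c where "a \<in> {c \<in> T - {u}. Gr u c}" "b \<in> {c \<in> T - {u}. Gr u c}"
        "c \<in> {c \<in> T - {u}. Gr u c}" "a < b" "b < c"
        using three_elements_sorted[of "{c \<in> T - {u}. Gr u c}"] finT by auto
      then have abc: "a \<in> T - {u}" "b \<in> T - {u}" "c \<in> T - {u}" "Gr u a" "Gr u b" "Gr u c" "a < b" "b < c"
        by auto
      have SS: "S a b" "S b c" "S a c" "S u a" "S u b" "S u c" using abc cl C by auto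
      have sym: "S a u" "S b u" "S c u" "Gr a u" "Gr b u" "Gr c u"
        using SS abc S Gr by blast+
      have V4: "a \<in> V" "b \<in> V" "c \<in> V" "u \<in> V" using abc TV u by auto
      have "u \<noteq> a" "u \<noteq> b" "u \<noteq> c" using abc by auto
      \<comment> \<open>In every position of \<open>u\<close>, one diagonal of the sorted quadruple
        joins \<open>u\<close> to one of its three gray neighbours.\<close>
      then consider "u < a" | "a < u" "u < b" | "b < u" "u < c" | "c < u" by linarith
      then show False
      proof cases
        case 1 then show False using psubset.prems[of u a b c] V4 SS sym abc by simp
      next
        case 2 then show False using psubset.prems[of a u b c] V4 SS sym abc by simp
      next
        case 3 then show False using psubset.prems[of a b u c] V4 SS sym abc by simp
      next
        case 4 then show False using psubset.prems[of a b c u] V4 SS sym abc by simp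
      qed
    qed
    have sumT: "(\<Sum>t\<in>T. \<phi> u t) = real (card {c \<in> T - {u}. Gr u c}) - 2 * real (card {c \<in> T - {u}. \<not> S u c})" for u
    proof -
      have "(\<Sum>t\<in>T. \<phi> u t) = (\<Sum>t\<in>T. of_bool (t \<noteq> u \<and> Gr u t)) - 2 * (\<Sum>t\<in>T. of_bool (t \<noteq> u \<and> \<not> S u t))"
        unfolding sum_distrib_left sum_subtractf[symmetric] by (intro sum.cong) (auto simp: \<phi>_def)
      also have "(\<Sum>t\<in>T. of_bool (t \<noteq> u \<and> Gr u t)) = real (card {c \<in> T - {u}. Gr u c})"
        using finT by (simp add: sum_of_bool_eq) (intro arg_cong[of _ _ card], auto)
      also have "(\<Sum>t\<in>T. of_bool (t \<noteq> u \<and> \<not> S u t)) = real (card {c \<in> T - {u}. \<not> S u c})"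
        using finT by (simp add: sum_of_bool_eq) (intro arg_cong[of _ _ card], auto)
      finally show ?thesis .
    qed
    have inT: "(\<Sum>t\<in>T. \<phi> u t) \<le> 2" if "u \<in> T" for u
      unfolding sumT using deg[of u] that TV GS by fastforce
    have outT: "(\<Sum>t\<in>T. \<phi> u t) \<le> 0" if u: "u \<in> V - T" for u
    proof -
      have "card {c \<in> T - {u}. \<not> S u c} \<noteq> 0"
      proof
        assume "card {c \<in> T - {u}. \<not> S u c} = 0"
        then have "insert u T \<in> Q" using u finT TV cl by (auto simp: Q_def intro: S[THEN iffD1])
        then show False using max[of "insert u T"] u by blast
      qed
      then show ?thesis unfolding sumT using deg[of u] u GS by fastforce
    qed
    define R where "R = V - T"
    have V: "V = T \<union> R" "T \<inter> R = {}" and finR: "finite R" using TV psubset.hyps by (auto simp: R_def)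
    have "R \<subset> V" using T TV by (auto simp: R_def)
    have IH: "(\<Sum>i\<in>R. \<Sum>j\<in>R. \<phi> i j) \<le> 2 * real (card R)"
      by (rule psubset.IH[OF \<open>R \<subset> V\<close>], rule psubset.prems) (use \<open>R \<subset> V\<close> in auto)
    have sym: "\<phi> i j = \<phi> j i" for i j using S[of i j] Gr[of i j] by (simp add: \<phi>_def)
    have "(\<Sum>i\<in>V. \<Sum>j\<in>V. \<phi> i j) = (\<Sum>i\<in>T. \<Sum>j\<in>T. \<phi> i j) + (\<Sum>i\<in>T. \<Sum>j\<in>R. \<phi> i j)
        + (\<Sum>i\<in>R. \<Sum>j\<in>T. \<phi> i j) + (\<Sum>i\<in>R. \<Sum>j\<in>R. \<phi> i j)"
      using finT finR V(2) unfolding V(1) by (simp add: sum.union_disjoint sum.distrib)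
    also have "(\<Sum>i\<in>T. \<Sum>j\<in>R. \<phi> i j) = (\<Sum>i\<in>R. \<Sum>j\<in>T. \<phi> i j)"
      by (subst sum.swap) (simp add: sym)
    also have "(\<Sum>i\<in>R. \<Sum>j\<in>T. \<phi> i j) \<le> (\<Sum>i\<in>R. 0)"
      by (intro sum_mono outT) (auto simp: R_def)
    also have "(\<Sum>i\<in>T. \<Sum>j\<in>T. \<phi> i j) \<le> (\<Sum>i\<in>T. 2)"
      by (intro sum_mono inT)
    finally have "(\<Sum>i\<in>V. \<Sum>j\<in>V. \<phi> i j) \<le> 2 * real (card T) + 2 * real (card R)"
      using IH by simp
    also have "\<dots> = 2 * real (card V)"
      using finT finR V by (simp add: card_Un_disjoint)
    finally show ?thesis .
  qed simp
qed

section \<open>Embedding a four-cycle that misses a diagonal\<close>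

text \<open>The half of regularity that embedding uses: large subsets keep density at least
  \<open>\<delta>\<close>. Without a quotient, empty subsets need no exception.\<close>

definition lower_regular :: "real \<Rightarrow> real \<Rightarrow> ('a \<Rightarrow> 'a \<Rightarrow> real) \<Rightarrow> 'a set \<Rightarrow> 'a set \<Rightarrow> bool" where
  "lower_regular \<eta> \<delta> h X Y \<longleftrightarrow>
     (\<forall>A B. A \<subseteq> X \<longrightarrow> B \<subseteq> Y \<longrightarrow> \<eta> * card X \<le> card A \<longrightarrow> \<eta> * card Y \<le> card B \<longrightarrow>
        \<delta> * card A * card B \<le> (\<Sum>x\<in>A. \<Sum>y\<in>B. h x y))"

lemma lower_regular_commute:
  assumes "\<And>x y. h x y = h y x" "lower_regular \<eta> \<delta> h X Y"
  shows "lower_regular \<eta> \<delta> h Y X"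
proof -
  have *: "(\<Sum>x\<in>A. \<Sum>y\<in>B. h x y) = (\<Sum>x\<in>B. \<Sum>y\<in>A. h x y)" for A B
    by (subst sum.swap) (simp add: assms(1))
  show ?thesis unfolding lower_regular_def
  proof (intro allI impI)
    fix A B assume "A \<subseteq> Y" "B \<subseteq> X" "\<eta> * card Y \<le> card A" "\<eta> * card X \<le> card B"
    then have "\<delta> * card B * card A \<le> (\<Sum>x\<in>B. \<Sum>y\<in>A. h x y)"
      using assms(2) unfolding lower_regular_def by blast
    then show "\<delta> * card A * card B \<le> (\<Sum>x\<in>A. \<Sum>y\<in>B. h x y)"
      unfolding *[of A B] by (simp add: mult_ac)
  qed
qed

text \<open>If the low-degree vertices formed a large set, that set and \<open>B\<close> would
  together violate the density bound.\<close>

lemma lower_regular_few_low_degree: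
  fixes h :: "'a \<Rightarrow> 'a \<Rightarrow> real" and \<eta> \<delta> :: real
  assumes "lower_regular \<eta> \<delta> h X Y" "finite X" "finite Y" "X \<noteq> {}" "B \<subseteq> Y"
    and "0 < \<eta>" "\<eta> * card Y \<le> card B"
  shows "card {x \<in> X. (\<Sum>y\<in>B. h x y) < \<delta> * card B} < \<eta> * card X"
proof (rule ccontr)
  define A where "A = {x \<in> X. (\<Sum>y\<in>B. h x y) < \<delta> * card B}"
  assume "\<not> ?thesis"
  then have A: "\<eta> * card X \<le> card A" by (simp add: A_def)
  have "0 < \<eta> * card X" using assms by (simp add: card_gt_0_iff)
  with A have "card A > 0" by linarith
  then have "A \<noteq> {}" "finite A" by (auto simp: card_gt_0_iff)
  then have "(\<Sum>x\<in>A. \<Sum>y\<in>B. h x y) < (\<Sum>x\<in>A. \<delta> * card B)"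
    by (intro sum_strict_mono) (auto simp: A_def)
  moreover have "\<delta> * card A * card B \<le> (\<Sum>x\<in>A. \<Sum>y\<in>B. h x y)"
    using assms A unfolding lower_regular_def by (auto simp: A_def)
  ultimately show False by (simp add: mult_ac)
qed

text \<open>Greedy embedding: \<open>p\<close> is chosen with many neighbours in \<open>Q\<close>
  and in \<open>S\<close> and many non-neighbours in \<open>R\<close>; then \<open>r\<close>, among
  these non-neighbours, is chosen typical towards both neighbourhoods of \<open>p\<close>. Each
  choice avoids two exceptional sets of relative size below \<open>\<delta> / 2\<close> inside a set
  of relative size at least \<open>\<delta>\<close>.\<close>

lemma four_cycle_with_missing_diagonal:
  fixes h :: "'a \<Rightarrow> 'a \<Rightarrow> real"
  assumes fin: "finite P" "finite Q" "finite R" "finite S" and ne: "P \<noteq> {}" "Q \<noteq> {}" "R \<noteq> {}" "S \<noteq> {}"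
    and h: "\<And>x y. h x y = 0 \<or> h x y = 1" and \<delta>: "0 < \<delta>" "\<delta> \<le> 1"
    and reg: "lower_regular (\<delta> / 2) \<delta> h P Q" "lower_regular (\<delta> / 2) \<delta> h P S"
      "lower_regular (\<delta> / 2) \<delta> h R Q" "lower_regular (\<delta> / 2) \<delta> h R S"
    and dens: "(\<Sum>p\<in>P. \<Sum>r\<in>R. h p r) \<le> (1 - 2 * \<delta>) * card P * card R"
  shows "\<exists>p\<in>P. \<exists>q\<in>Q. \<exists>r\<in>R. \<exists>s\<in>S. h p q = 1 \<and> h p s = 1 \<and> h r q = 1 \<and> h r s = 1 \<and> h p r = 0"
proof -
  have h0: "0 \<le> h x y" for x y using h[of x y] by auto
  have half: "\<delta> / 2 * real m \<le> real m" for m using \<delta> mult_left_le_one_le[of "real m" "\<delta> / 2"] by simp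
  define L1 where "L1 = {p\<in>P. (\<Sum>y\<in>Q. h p y) < \<delta> * card Q}"
  define L2 where "L2 = {p\<in>P. (\<Sum>y\<in>S. h p y) < \<delta> * card S}"
  define L3 where "L3 = {p\<in>P. (\<Sum>r\<in>R. 1 - h p r) < \<delta> * card R}"
  have c1: "card L1 < \<delta> / 2 * card P" unfolding L1_def
    by (rule lower_regular_few_low_degree[OF reg(1)]) (use fin ne \<delta> half in auto)
  have c2: "card L2 < \<delta> / 2 * card P" unfolding L2_def
    by (rule lower_regular_few_low_degree[OF reg(2)]) (use fin ne \<delta> half in auto)
  have R0: "real (card R) > 0" using fin ne by (simp add: card_gt_0_iff)
  \<comment> \<open>Averaging uses up one \<open>\<delta>\<close> of the \<open>2 * \<delta>\<close>
    in \<open>dens\<close>: vertices of \<open>L3\<close> carry at most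
    \<open>\<delta> * card P * card R\<close> of the missing pairs.\<close>
  have c3: "\<delta> * card P \<le> card (P - L3)"
  proof -
    have "2 * \<delta> * card P * card R \<le> (\<Sum>p\<in>P. \<Sum>r\<in>R. 1 - h p r)"
      using dens by (simp add: sum_subtractf algebra_simps)
    also have "\<dots> = (\<Sum>p\<in>L3. \<Sum>r\<in>R. 1 - h p r) + (\<Sum>p\<in>P - L3. \<Sum>r\<in>R. 1 - h p r)"
      using fin by (subst sum.subset_diff[of L3]) (auto simp: L3_def)
    also have "(\<Sum>p\<in>L3. \<Sum>r\<in>R. 1 - h p r) \<le> (\<Sum>p\<in>L3. \<delta> * card R)"
      by (intro sum_mono) (auto simp: L3_def)
    also have "\<dots> = card L3 * (\<delta> * card R)" by simp
    also have "\<dots> \<le> card P * (\<delta> * card R)"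
      using fin \<delta> by (intro mult_right_mono) (auto simp: L3_def intro!: card_mono)
    also have "(\<Sum>p\<in>P - L3. \<Sum>r\<in>R. 1 - h p r) \<le> (\<Sum>p\<in>P - L3. \<Sum>r\<in>R. 1)"
      by (intro sum_mono) (simp add: h0)
    finally have "(\<delta> * card P) * card R \<le> real (card (P - L3)) * card R" by (simp add: algebra_simps del: of_nat_mult)
    then show ?thesis using R0 by (rule mult_right_le_imp_le)
  qed
  have "\<not> P - L3 \<subseteq> L1 \<union> L2"
  proof
    assume "P - L3 \<subseteq> L1 \<union> L2"
    then have "card (P - L3) \<le> card (L1 \<union> L2)" using fin by (intro card_mono) (auto simp: L1_def L2_def)
    also have "\<dots> \<le> card L1 + card L2" by (rule card_Un_le)
    finally show False using c1 c2 c3 by linarith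
  qed
  then obtain p where p: "p \<in> P" "p \<notin> L1" "p \<notin> L2" "p \<notin> L3" by blast
  define N where "N Z = {z \<in> Z. h p z = 1}" for Z
  have sumN: "(\<Sum>z\<in>Z. h p z) = card (N Z)" if "finite Z" for Z
  proof -
    have "(\<Sum>z\<in>Z. h p z) = (\<Sum>z\<in>Z. of_bool (h p z = 1))" using h by (intro sum.cong refl) (metis of_bool_eq zero_neq_one cancel_comm_monoid_add_class.diff_cancel diff_zero)
    then show ?thesis using that by (simp add: sum_of_bool_eq N_def Collect_conj_eq Int_commute)
  qed
  have NQ: "\<delta> * card Q \<le> card (N Q)" and NS: "\<delta> * card S \<le> card (N S)"
    using p sumN fin by (auto simp: L1_def L2_def)
  define R' where "R' = {r \<in> R. h p r = 0}"
  have "(\<Sum>r\<in>R. 1 - h p r) = (\<Sum>r\<in>R. of_bool (h p r = 0))" using h by (intro sum.cong refl) (metis of_bool_eq zero_neq_one cancel_comm_monoid_add_class.diff_cancel diff_zero)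
  then have R': "\<delta> * card R \<le> card R'"
    using p fin by (simp add: L3_def sum_of_bool_eq R'_def Collect_conj_eq Int_commute)
  define M where "M Z = {r \<in> R. (\<Sum>y\<in>N Z. h r y) < \<delta> * card (N Z)}" for Z
  \<comment> \<open>The neighbourhoods of \<open>p\<close> exceed the regularity scale
    \<open>\<delta> / 2\<close>, so \<open>reg\<close> applies to them.\<close>
  have "\<delta> / 2 * card Q \<le> \<delta> * card Q" "\<delta> / 2 * card S \<le> \<delta> * card S" using \<delta> by auto
  then have m: "card (M Q) < \<delta> / 2 * card R" "card (M S) < \<delta> / 2 * card R"
    unfolding M_def
    by (intro lower_regular_few_low_degree[OF reg(3)] lower_regular_few_low_degree[OF reg(4)];
        use fin ne \<delta> NQ NS in \<open>auto simp: N_def\<close>)+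
  have "\<not> R' \<subseteq> M Q \<union> M S"
  proof
    assume "R' \<subseteq> M Q \<union> M S"
    then have "card R' \<le> card (M Q \<union> M S)" using fin by (intro card_mono) (auto simp: M_def)
    also have "\<dots> \<le> card (M Q) + card (M S)" by (rule card_Un_le)
    finally show False using m R' by linarith
  qed
  then obtain r where r: "r \<in> R" "h p r = 0" "r \<notin> M Q" "r \<notin> M S" by (auto simp: R'_def)
  have ex: "\<exists>z\<in>Z. h p z = 1 \<and> h r z = 1" if "r \<notin> M Z" "\<delta> * card Z \<le> card (N Z)" "finite Z" "Z \<noteq> {}" for Z
  proof (rule ccontr)
    assume "\<not> ?thesis"
    then have "(\<Sum>y\<in>N Z. h r y) = 0" using h by (intro sum.neutral ballI) (auto simp: N_def)
    moreover have "0 < \<delta> * card Z" using that \<delta> by (simp add: card_gt_0_iff)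
    then have "0 < \<delta> * card (N Z)" using that \<delta> by simp
    ultimately show False using that r by (simp add: M_def)
  qed
  show ?thesis using ex[OF r(3) NQ] ex[OF r(4) NS] fin ne p r by blast
qed

section \<open>Regular subtuples\<close>

definition density :: "('a \<Rightarrow> 'a \<Rightarrow> real) \<Rightarrow> 'a set \<Rightarrow> 'a set \<Rightarrow> real" where
  "density f X Y = (\<Sum>x\<in>X. \<Sum>y\<in>Y. f x y) / (card X * card Y)"

lemma density_bounds:
  assumes "\<And>x y. 0 \<le> f x y \<and> f x y \<le> 1"
  shows "0 \<le> density f X Y" "density f X Y \<le> 1"
proof -
  have "(\<Sum>x\<in>X. \<Sum>y\<in>Y. f x y) \<le> (\<Sum>x\<in>X. \<Sum>y\<in>Y. 1)"
    using assms by (intro sum_mono) auto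
  then show "density f X Y \<le> 1" by (auto simp: density_def divide_le_eq_1 zero_less_mult_iff card_gt_0_iff)
  show "0 \<le> density f X Y" unfolding density_def
    using assms by (intro divide_nonneg_nonneg sum_nonneg) auto
qed

lemma density_flip: "density f X Y = density (\<lambda>x y. f y x) Y X"
  unfolding density_def by (subst sum.swap) (simp add: mult.commute)

lemma density_split:
  assumes "finite X" "A \<subseteq> X"
  shows "card A / card X * density f A Y + card (X - A) / card X * density f (X - A) Y = density f X Y"
proof -
  have *: "card Z / card X * density f Z Y = (\<Sum>x\<in>Z. \<Sum>y\<in>Y. f x y) / (card X * card Y)"
    if "Z \<subseteq> X" for Z
  proof -
    have "finite Z" using that assms finite_subset by blast
    then show ?thesis by (cases "Z = {}") (auto simp: density_def)
  qed
  have "(\<Sum>x\<in>X. \<Sum>y\<in>Y. f x y) = (\<Sum>x\<in>X - A. \<Sum>y\<in>Y. f x y) + (\<Sum>x\<in>A. \<Sum>y\<in>Y. f x y)"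
    by (rule sum.subset_diff) (use assms in auto)
  then show ?thesis using *[of A] *[of "X - A"] assms by (simp add: density_def add_divide_distrib)
qed

definition pairs_below :: "nat \<Rightarrow> (nat \<times> nat) set" where
  "pairs_below k = {(i, j). i < j \<and> j < k}"

lemma finite_pairs_below [simp]: "finite (pairs_below k)"
  by (rule finite_subset[of _ "{..<k} \<times> {..<k}"]) (auto simp: pairs_below_def)

text \<open>Choosing \<open>A\<close> or its complement with probability proportional to size
  preserves the mean density of all pairs of the tuple simultaneously: pairs through
  \<open>i\<close> by splitting, the others because the weights add up to 1. For
  \<open>a = b = i\<close> this would fail, as both arguments would move.\<close>

lemma density_split_tuple:
  fixes X :: "nat \<Rightarrow> 'a set"
  assumes "finite (X i)" "X i \<noteq> {}" "A \<subseteq> X i" "a \<noteq> b"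
  shows "card A / card (X i) * density f ((X(i := A)) a) ((X(i := A)) b) +
    card (X i - A) / card (X i) * density f ((X(i := X i - A)) a) ((X(i := X i - A)) b) = density f (X a) (X b)"
proof -
  consider "a = i" "b \<noteq> i" | "a \<noteq> i" "b = i" | "a \<noteq> i" "b \<noteq> i" using assms by blast
  then show ?thesis
  proof cases
    case 1 then show ?thesis using density_split[OF assms(1,3)] by simp
  next
    case 2 then show ?thesis
      using density_split[OF assms(1,3), of "\<lambda>x y. f y x" "X a"] by (simp add: density_flip[of f "X a"])
  next
    case 3
    have one: "real (card A) / card (X i) + card (X i - A) / card (X i) = 1"
      using assms by (simp add: card_Diff_subset finite_subset card_mono of_nat_diff field_simps)
    then show ?thesis 
      by (simp only: fun_upd_other[OF 3(1)] fun_upd_other[OF 3(2)] distrib_right[symmetric] one mult_1)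
  qed
qed

text \<open>This is \<open>t * ln (1 / t) \<le> 1 - t\<close>. Adding it for the two halves of a
  split shows that the expected logarithm of the size drops by at most 1, however unbalanced the
  split is.\<close>

lemma mult_ln_ge: 
  assumes "finite X" "X \<noteq> {}" "A \<subseteq> X"
  shows "card A / card X * ln (card A) \<ge> card A / card X * ln (card X) + card A / card X - 1"
proof (cases "A = {}")
  case False
  define \<alpha> where "\<alpha> = real (card A) / card X"
  have pos: "real (card A) > 0" "real (card X) > 0"
    using assms False finite_subset by (auto simp: card_gt_0_iff)
  then have a: "\<alpha> > 0" by (simp add: \<alpha>_def)
  have "ln (inverse \<alpha>) \<le> inverse \<alpha> - 1" using a by (intro ln_le_minus_one) simp
  then have "\<alpha> * ln (inverse \<alpha>) \<le> \<alpha> * (inverse \<alpha> - 1)" using a by (intro mult_left_mono) auto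
  then have "- (\<alpha> * ln \<alpha>) \<le> 1 - \<alpha>" using a by (simp add: ln_inverse right_diff_distrib)
  moreover have "ln \<alpha> = ln (card A) - ln (card X)" using pos by (simp add: \<alpha>_def ln_div)
  ultimately show ?thesis unfolding \<alpha>_def[symmetric] by (simp add: algebra_simps)
qed simp

text \<open>The second moment is the squared mean plus the variance, of which only the
  \<open>True True\<close> term is kept.\<close>

lemma four_point_variance:
  fixes w v :: "bool \<Rightarrow> bool \<Rightarrow> real"
  assumes w: "\<And>s t. 0 \<le> w s t" "(\<Sum>s\<in>UNIV. \<Sum>t\<in>UNIV. w s t) = 1"
    and m: "(\<Sum>s\<in>UNIV. \<Sum>t\<in>UNIV. w s t * v s t) = m"
  shows "m\<^sup>2 + w True True * (v True True - m)\<^sup>2 \<le> (\<Sum>s\<in>UNIV. \<Sum>t\<in>UNIV. w s t * (v s t)\<^sup>2)"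
proof -
  have "(\<Sum>s\<in>UNIV. \<Sum>t\<in>UNIV. w s t * (v s t - m)\<^sup>2) =
    (\<Sum>s\<in>UNIV. \<Sum>t\<in>UNIV. w s t * (v s t)\<^sup>2) - 2 * m * (\<Sum>s\<in>UNIV. \<Sum>t\<in>UNIV. w s t * v s t)
      + m\<^sup>2 * (\<Sum>s\<in>UNIV. \<Sum>t\<in>UNIV. w s t)"
    by (simp add: UNIV_bool algebra_simps power2_eq_square)
  also have "\<dots> = (\<Sum>s\<in>UNIV. \<Sum>t\<in>UNIV. w s t * (v s t)\<^sup>2) - m\<^sup>2"
    unfolding w m by (simp add: power2_eq_square)
  finally have *: "(\<Sum>s\<in>UNIV. \<Sum>t\<in>UNIV. w s t * (v s t - m)\<^sup>2) = (\<Sum>s\<in>UNIV. \<Sum>t\<in>UNIV. w s t * (v s t)\<^sup>2) - m\<^sup>2" .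
  have "0 \<le> w s t * (v s t - m)\<^sup>2" for s t using w by simp
  from this[of True False] this[of False True] this[of False False]
  have "w True True * (v True True - m)\<^sup>2 \<le> (\<Sum>s\<in>UNIV. \<Sum>t\<in>UNIV. w s t * (v s t - m)\<^sup>2)"
    by (simp add: UNIV_bool)
  with * show ?thesis by simp
qed

text \<open>The subtuple minimises a potential: the cost density, minus \<open>c\<close> times the energy of \<open>h\<close>, minus a
  small multiple of the sum of the \<open>ln (card (X i))\<close>. If \<open>(A, B)\<close> witnesses irregularity of \<open>(X i, X j)\<close>,
  split \<open>X i\<close> and \<open>X j\<close> along \<open>A\<close> and \<open>B\<close> and choose one of the four resulting tuples with probability
  proportional to size: on average the cost is unchanged, the energy grows by \<open>\<eta>\<^sup>2 * \<epsilon>\<^sup>2\<close>, and the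
  logarithmic term changes by at most an entropy, which is bounded whatever the sizes of \<open>A\<close> and \<open>B\<close>.\<close>

lemma regular_subtuple:
  fixes I :: "nat \<Rightarrow> 'a set" and d h :: "'a \<Rightarrow> 'a \<Rightarrow> real"
  assumes I_all: "\<forall>i<k. finite (I i) \<and> I i \<noteq> {}"
    and d: "\<And>x y. 0 \<le> d x y \<and> d x y \<le> 1" and h: "\<And>x y. 0 \<le> h x y \<and> h x y \<le> 1"
    and pos: "c > 0" "\<eta> > 0" "\<epsilon> > 0"
  defines "K \<equiv> real (card (pairs_below k))"
  defines "\<kappa> \<equiv> exp (- (K + c * K) / (c * \<eta>\<^sup>2 * \<epsilon>\<^sup>2 / 4))"
  shows "\<exists>X. (\<forall>i<k. X i \<subseteq> I i \<and> X i \<noteq> {} \<and> \<kappa> * card (I i) \<le> card (X i))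
    \<and> (\<Sum>(i, j)\<in>pairs_below k. density d (X i) (X j)) \<le> (\<Sum>(i, j)\<in>pairs_below k. density d (I i) (I j)) + c * K
    \<and> (\<forall>i j A B. i < j \<longrightarrow> j < k \<longrightarrow> A \<subseteq> X i \<longrightarrow> B \<subseteq> X j \<longrightarrow> \<eta> * card (X i) \<le> card A \<longrightarrow> \<eta> * card (X j) \<le> card B
        \<longrightarrow> \<bar>density h A B - density h (X i) (X j)\<bar> < \<epsilon>)"
proof -
  note I = I_all[rule_format]
  \<comment> \<open>With this weight the energy gain
    \<open>c * \<eta>\<^sup>2 * \<epsilon>\<^sup>2\<close> equals \<open>4 * l\<close>, while the
    two splits lose at most \<open>2 * l\<close> in the logarithmic term.\<close>
  define l where "l = c * \<eta>\<^sup>2 * \<epsilon>\<^sup>2 / 4"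
  have l: "l > 0" using pos by (simp add: l_def)
  define D where "D X = (\<Sum>(i, j)\<in>pairs_below k. density d (X i) (X j))" for X
  define q where "q X = (\<Sum>(i, j)\<in>pairs_below k. (density h (X i) (X j))\<^sup>2)" for X
  define e where "e X = (\<Sum>i<k. ln (real (card (X i))))" for X :: "nat \<Rightarrow> 'a set"
  define \<Psi> where "\<Psi> X = D X - c * q X - l * e X" for X
  define \<X> where "\<X> = PiE {..<k} (\<lambda>i. Pow (I i) - {{}})"
  define I0 where "I0 = restrict I {..<k}"
  have I0: "I0 \<in> \<X>" using I by (auto simp: I0_def \<X>_def)
  have "finite \<X>" using I by (auto simp: \<X>_def intro!: finite_PiE)
  with I0 obtain X where X: "X \<in> \<X>" and min: "\<And>Y. Y \<in> \<X> \<Longrightarrow> \<Psi> X \<le> \<Psi> Y"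
    using ex_is_arg_min_if_finite[of \<X> \<Psi>] by (auto simp: is_arg_min_linorder)
  have Xi: "X i \<subseteq> I i" "X i \<noteq> {}" "finite (X i)" if "i < k" for i
    using X that I[OF that] finite_subset by (auto simp: \<X>_def PiE_iff)
  have ln_le: "ln (card (X i)) \<le> ln (card (I i))" if "i < k" for i
    using Xi[OF that] I[OF that] by (intro ln_mono) (auto simp: card_gt_0_iff card_mono)
  have eI: "e I0 = (\<Sum>i<k. ln (real (card (I i))))" unfolding e_def by (intro sum.cong) (auto simp: I0_def)
  have DI: "D I0 = (\<Sum>(i, j)\<in>pairs_below k. density d (I i) (I j))"
    unfolding D_def by (intro sum.cong) (auto simp: I0_def pairs_below_def)
  have q: "0 \<le> q Y" "q Y \<le> K" for Y
  proof -
    show "0 \<le> q Y" unfolding q_def by (intro sum_nonneg) auto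
    have "q Y \<le> (\<Sum>p\<in>pairs_below k. 1)" unfolding q_def
      using density_bounds[OF h] by (intro sum_mono) (auto intro!: power_le_one)
    then show "q Y \<le> K" by (simp add: K_def)
  qed
  have D: "0 \<le> D Y" "D Y \<le> K" for Y
  proof -
    show "0 \<le> D Y" unfolding D_def using density_bounds[OF d] by (intro sum_nonneg) auto
    have "D Y \<le> (\<Sum>p\<in>pairs_below k. 1)" unfolding D_def
      using density_bounds[OF d] by (intro sum_mono) auto
    then show "D Y \<le> K" by (simp add: K_def)
  qed
  \<comment> \<open>Comparison of the minimiser with the starting tuple; it yields both the cost
    bound and the lower bound on the sizes.\<close>
  have PI: "D X + l * (e I0 - e X) \<le> D I0 + c * q X - c * q I0"
    using min[OF I0] by (simp add: \<Psi>_def algebra_simps)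
  have "c * q X \<le> c * K" "0 \<le> c * q I0" using q pos by auto
  with PI have PI': "D X + l * (e I0 - e X) \<le> D I0 + c * K" by linarith
  have "e X \<le> e I0" unfolding eI by (auto simp: e_def intro!: sum_mono ln_le)
  then have "0 \<le> l * (e I0 - e X)" using l by simp
  with PI' have concl2: "D X \<le> D I0 + c * K" by linarith
  \<comment> \<open>No summand of \<open>e I0 - e X\<close> is negative, so each is bounded by the
    whole, which is at most \<open>(K + c * K) / l\<close>. Exponentiating gives
    \<open>\<kappa>\<close>.\<close>
  have concl1: "\<kappa> * card (I i) \<le> card (X i)" if i: "i < k" for i
  proof -
    have "ln (card (I i)) - ln (card (X i)) \<le> (\<Sum>i<k. ln (real (card (I i))) - ln (card (X i)))"
      using i ln_le by (intro member_le_sum) auto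
    also have "\<dots> = e I0 - e X" unfolding eI by (simp add: sum_subtractf e_def)
    finally have "l * (ln (card (I i)) - ln (card (X i))) \<le> l * (e I0 - e X)" using l by (intro mult_left_mono) auto
    also have "\<dots> \<le> K + c * K" using PI' D[of X] D[of I0] by linarith
    finally have "ln (card (I i)) - ln (card (X i)) \<le> (K + c * K) / l"
      using l by (simp add: field_simps)
    then have "- (K + c * K) / l + ln (card (I i)) \<le> ln (card (X i))" unfolding minus_divide_left[symmetric] by linarith
    then have "exp (- (K + c * K) / l + ln (card (I i))) \<le> exp (ln (card (X i)))" by simp
    then show ?thesis using Xi[OF i] I[OF i] unfolding \<kappa>_def l_def exp_add
      by (simp add: card_gt_0_iff)
  qed
  have concl3: "\<bar>density h A B - density h (X i) (X j)\<bar> < \<epsilon>"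
    if ij: "i < j" "j < k" and AB: "A \<subseteq> X i" "B \<subseteq> X j" and big: "\<eta> * card (X i) \<le> card A" "\<eta> * card (X j) \<le> card B" for i j A B
  proof (rule ccontr)
    assume neg: "\<not> ?thesis"
    have ne: "i < k" "i \<noteq> j" "j \<noteq> i" using ij by auto
    note Xi' = Xi[OF ne(1)] Xi[OF ij(2)]
    have bool_sum: "(\<Sum>s\<in>UNIV. g s) = g True + g False" for g :: "bool \<Rightarrow> real"
      by (simp add: UNIV_bool)
    define P where "P s = (if s then A else X i - A)" for s
    define Q where "Q t = (if t then B else X j - B)" for t
    define \<alpha> where "\<alpha> s = card (P s) / card (X i)" for s
    define \<beta> where "\<beta> t = card (Q t) / card (X j)" for t
    define Y where "Y s t = X(j := Q t, i := P s)" for s t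
    have sums: "(\<Sum>s\<in>UNIV. \<alpha> s) = 1" "(\<Sum>t\<in>UNIV. \<beta> t) = 1"
      using Xi' AB by (simp_all add: UNIV_bool \<alpha>_def \<beta>_def P_def Q_def card_Diff_subset finite_subset card_mono of_nat_diff field_simps)
    have nonneg: "0 \<le> \<alpha> s" "0 \<le> \<beta> t" for s t by (simp_all add: \<alpha>_def \<beta>_def)
    \<comment> \<open>The two splits are independent, also for pairs that involve both
      \<open>i\<close> and \<open>j\<close>.\<close>
    define w where "w s t = \<alpha> s * \<beta> t" for s t
    have wn: "0 \<le> w s t" for s t using nonneg by (simp add: w_def)
    have wsum: "(\<Sum>s\<in>UNIV. \<Sum>t\<in>UNIV. w s t) = 1"
      unfolding w_def using sums by (simp flip: sum_distrib_left)
    have avg: "(\<Sum>s\<in>UNIV. \<Sum>t\<in>UNIV. w s t * density f (Y s t a) (Y s t b)) = density f (X a) (X b)"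
      if "a \<noteq> b" for a b f
    proof -
      have 1: "(\<Sum>s\<in>UNIV. \<alpha> s * density f (Y s t a) (Y s t b)) = density f ((X(j := Q t)) a) ((X(j := Q t)) b)" for t
      proof -
        have XI: "(X(j := Q t)) i = X i" using ne by simp
        show ?thesis
          using density_split_tuple[of "X(j := Q t)" i A a b f, unfolded XI, OF Xi'(3,2) AB(1) that]
          by (simp only: bool_sum \<alpha>_def P_def Y_def if_True if_False)
      qed
      have 2: "(\<Sum>t\<in>UNIV. \<beta> t * density f ((X(j := Q t)) a) ((X(j := Q t)) b)) = density f (X a) (X b)"
        using density_split_tuple[of X j B a b f, OF Xi'(6,5) AB(2) that]
        by (simp only: bool_sum \<beta>_def Q_def if_True if_False)
      have "(\<Sum>s\<in>UNIV. \<Sum>t\<in>UNIV. w s t * density f (Y s t a) (Y s t b)) =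
        (\<Sum>t\<in>UNIV. \<beta> t * (\<Sum>s\<in>UNIV. \<alpha> s * density f (Y s t a) (Y s t b)))"
        unfolding sum_distrib_left w_def by (subst sum.swap) (simp add: mult_ac)
      then show ?thesis unfolding 1 2 .
    qed
    \<comment> \<open>An empty half would leave the family \<open>\<X>\<close>, but it has weight
      0.\<close>
    have minY: "w s t * \<Psi> X \<le> w s t * \<Psi> (Y s t)" for s t
    proof (cases "P s = {} \<or> Q t = {}")
      case True
      then have "w s t = 0" by (auto simp: w_def \<alpha>_def \<beta>_def)
      then show ?thesis by simp
    next
      case False
      have "P s \<subseteq> I i" "Q t \<subseteq> I j" using Xi' AB by (auto simp: P_def Q_def)
      then have "Y s t \<in> \<X>" using X False ij ne unfolding Y_def \<X>_def PiE_iff extensional_def by auto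
      then show ?thesis using wn by (intro mult_left_mono min) auto
    qed
    have avgD: "(\<Sum>s\<in>UNIV. \<Sum>t\<in>UNIV. w s t * D (Y s t)) = D X"
    proof -
      have "(\<Sum>s\<in>UNIV. \<Sum>t\<in>UNIV. w s t * D (Y s t)) =
        (\<Sum>(a, b)\<in>pairs_below k. (\<Sum>s\<in>UNIV. \<Sum>t\<in>UNIV. w s t * density d (Y s t a) (Y s t b)))"
        unfolding D_def by (simp add: UNIV_bool sum_distrib_left sum.distrib case_prod_unfold)
      also have "\<dots> = D X" unfolding D_def
        by (intro sum.cong refl) (auto simp: pairs_below_def avg)
      finally show ?thesis .
    qed
    \<comment> \<open>By convexity no pair loses energy on average. The pair \<open>(i, j)\<close>
      gains, since the outcome \<open>(A, B)\<close> has probability at least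
      \<open>\<eta>\<^sup>2\<close> and deviates by at least \<open>\<epsilon>\<close>.\<close>
    have avgq: "q X + \<eta>\<^sup>2 * \<epsilon>\<^sup>2 \<le> (\<Sum>s\<in>UNIV. \<Sum>t\<in>UNIV. w s t * q (Y s t))"
    proof -
      have "w True True \<ge> \<eta> * \<eta>"
        unfolding w_def \<alpha>_def \<beta>_def P_def Q_def using big pos Xi'
        by (intro mult_mono) (auto simp: field_simps card_gt_0_iff)
      moreover have "(density h A B - density h (X i) (X j))\<^sup>2 \<ge> \<epsilon>\<^sup>2"
        using neg pos by (metis abs_le_square_iff abs_of_pos not_less)
      ultimately have gain: "\<eta>\<^sup>2 * \<epsilon>\<^sup>2 \<le> w True True * (density h A B - density h (X i) (X j))\<^sup>2"
        using pos wn by (intro mult_mono) (auto simp: power2_eq_square)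
      define g where "g a b = (if a = i \<and> b = j then \<eta>\<^sup>2 * \<epsilon>\<^sup>2 else 0)" for a b
      have pair: "(density h (X a) (X b))\<^sup>2 + g a b \<le> (\<Sum>s\<in>UNIV. \<Sum>t\<in>UNIV. w s t * (density h (Y s t a) (Y s t b))\<^sup>2)"
        if "a < b" for a b
      proof -
        have "(density h (X a) (X b))\<^sup>2 + w True True * (density h (Y True True a) (Y True True b) - density h (X a) (X b))\<^sup>2
          \<le> (\<Sum>s\<in>UNIV. \<Sum>t\<in>UNIV. w s t * (density h (Y s t a) (Y s t b))\<^sup>2)"
          by (rule four_point_variance[OF wn wsum avg]) (use that in auto)
        moreover have "g a b \<le> w True True * (density h (Y True True a) (Y True True b) - density h (X a) (X b))\<^sup>2"
          using gain wn[of True True] ne by (auto simp: g_def Y_def P_def Q_def)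
        ultimately show ?thesis by linarith
      qed
      have "(\<Sum>(a, b)\<in>pairs_below k. g a b) = (\<Sum>p\<in>pairs_below k. if p = (i, j) then \<eta>\<^sup>2 * \<epsilon>\<^sup>2 else 0)"
        by (intro sum.cong) (auto simp: g_def split: if_splits)
      also have "\<dots> = \<eta>\<^sup>2 * \<epsilon>\<^sup>2"
        unfolding sum.delta[OF finite_pairs_below] using ij by (simp add: pairs_below_def)
      finally have "q X + \<eta>\<^sup>2 * \<epsilon>\<^sup>2 = (\<Sum>(a, b)\<in>pairs_below k. (density h (X a) (X b))\<^sup>2 + g a b)"
        by (simp add: q_def sum.distrib case_prod_unfold)
      also have "\<dots> \<le> (\<Sum>(a, b)\<in>pairs_below k. (\<Sum>s\<in>UNIV. \<Sum>t\<in>UNIV. w s t * (density h (Y s t a) (Y s t b))\<^sup>2))"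
        by (intro sum_mono) (auto simp: pairs_below_def intro!: pair)
      also have "\<dots> = (\<Sum>s\<in>UNIV. \<Sum>t\<in>UNIV. w s t * q (Y s t))"
        unfolding q_def by (simp add: UNIV_bool sum_distrib_left sum.distrib case_prod_unfold)
      finally show ?thesis .
    qed
    have avge: "e X - 2 \<le> (\<Sum>s\<in>UNIV. \<Sum>t\<in>UNIV. w s t * e (Y s t))"
    proof -
      have eY: "e (Y s t) = e X - ln (card (X i)) - ln (card (X j)) + ln (card (P s)) + ln (card (Q t))" for s t
      proof -
        have "e Z = (\<Sum>i\<in>{..<k} - {i, j}. ln (real (card (Z i)))) + ln (card (Z i)) + ln (card (Z j))" for Z :: "nat \<Rightarrow> 'a set"
          unfolding e_def using ij ne by (subst sum.subset_diff[of "{i, j}"]) auto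
        from this[of "Y s t"] this[of X] show ?thesis
          using ne by (simp add: Y_def)
      qed
      have \<alpha>ln: "(\<Sum>s\<in>UNIV. \<alpha> s * ln (card (P s))) \<ge> ln (card (X i)) - 1"
      proof -
        have "(\<Sum>s\<in>UNIV. \<alpha> s * ln (card (P s))) \<ge> (\<Sum>s\<in>UNIV. \<alpha> s * ln (card (X i)) + \<alpha> s - 1)"
          unfolding \<alpha>_def using Xi' AB by (intro sum_mono mult_ln_ge) (auto simp: P_def)
        then show ?thesis using sums(1) by (simp add: sum.distrib sum_subtractf flip: sum_distrib_right)
      qed
      have \<beta>ln: "(\<Sum>s\<in>UNIV. \<beta> s * ln (card (Q s))) \<ge> ln (card (X j)) - 1"
      proof -
        have "(\<Sum>s\<in>UNIV. \<beta> s * ln (card (Q s))) \<ge> (\<Sum>s\<in>UNIV. \<beta> s * ln (card (X j)) + \<beta> s - 1)"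
          unfolding \<beta>_def using Xi' AB by (intro sum_mono mult_ln_ge) (auto simp: Q_def)
        then show ?thesis using sums(2) by (simp add: sum.distrib sum_subtractf flip: sum_distrib_right)
      qed
      have "(\<Sum>s\<in>UNIV. \<Sum>t\<in>UNIV. w s t * e (Y s t)) =
        (e X - ln (card (X i)) - ln (card (X j))) * ((\<Sum>s\<in>UNIV. \<alpha> s) * (\<Sum>t\<in>UNIV. \<beta> t))
        + (\<Sum>s\<in>UNIV. \<alpha> s * ln (card (P s))) * (\<Sum>t\<in>UNIV. \<beta> t) + (\<Sum>s\<in>UNIV. \<alpha> s) * (\<Sum>t\<in>UNIV. \<beta> t * ln (card (Q t)))"
        unfolding eY w_def UNIV_bool by (simp add: algebra_simps)
      with \<alpha>ln \<beta>ln show ?thesis unfolding sums by simp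
    qed
    have "\<Psi> X = (\<Sum>s\<in>UNIV. \<Sum>t\<in>UNIV. w s t) * \<Psi> X" unfolding wsum by simp
    also have "\<dots> = (\<Sum>s\<in>UNIV. \<Sum>t\<in>UNIV. w s t * \<Psi> X)" by (simp add: sum_distrib_right)
    also have "\<dots> \<le> (\<Sum>s\<in>UNIV. \<Sum>t\<in>UNIV. w s t * \<Psi> (Y s t))" by (intro sum_mono minY)
    also have "\<dots> = (\<Sum>s\<in>UNIV. \<Sum>t\<in>UNIV. w s t * D (Y s t)) - c * (\<Sum>s\<in>UNIV. \<Sum>t\<in>UNIV. w s t * q (Y s t))
       - l * (\<Sum>s\<in>UNIV. \<Sum>t\<in>UNIV. w s t * e (Y s t))"
      unfolding \<Psi>_def UNIV_bool by (simp add: algebra_simps)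
    also have "\<dots> \<le> D X - c * (q X + \<eta>\<^sup>2 * \<epsilon>\<^sup>2) - l * (e X - 2)"
      unfolding avgD using pos l by (intro diff_mono mult_left_mono avgq avge order_refl) auto
    finally have "c * (\<eta>\<^sup>2 * \<epsilon>\<^sup>2) \<le> 2 * l" by (simp add: \<Psi>_def algebra_simps)
    moreover have "0 < c * (\<eta>\<^sup>2 * \<epsilon>\<^sup>2)" using pos by simp
    moreover have "l = c * (\<eta>\<^sup>2 * \<epsilon>\<^sup>2) / 4" by (simp add: l_def mult.assoc)
    ultimately show False by linarith
  qed
  show ?thesis
    using Xi(1,2) concl1 concl2 concl3 unfolding DI unfolding D_def by (intro exI[of _ X]) blast
qed

section \<open>Quasirandom graphs\<close>

lemma finite_all_pairs [simp]: "finite V \<Longrightarrow> finite (all_pairs V)"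
  by (rule finite_subset[of _ "Pow V"]) (auto simp: all_pairs_def)

text \<open>Centred adjacency, with mean 0 off the diagonal when edges appear with probability
  \<open>p\<close>. The value 0 on the diagonal keeps out the constant \<open>-p\<close> that loops
  would contribute when the two sets overlap.\<close>

definition bias :: "real \<Rightarrow> 'a set set \<Rightarrow> 'a \<Rightarrow> 'a \<Rightarrow> real" where
  "bias p G x y = (if x = y then 0 else of_bool ({x, y} \<in> G) - p)"

lemma bias_bound: "0 \<le> p \<Longrightarrow> p \<le> 1 \<Longrightarrow> \<bar>bias p G x y\<bar> \<le> 1"
  by (auto simp: bias_def)

lemma bias_commute: "bias p G x y = bias p G y x"
  by (auto simp: bias_def insert_commute)

text \<open>The fourth power of the Gowers box norm, without normalisation: the sum over all closed
  4-walks \<open>x y x' y'\<close> of the product of \<open>f\<close> along them.\<close>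

definition box_norm :: "('a \<Rightarrow> 'a \<Rightarrow> real) \<Rightarrow> 'a set \<Rightarrow> real" where
  "box_norm f V = (\<Sum>y\<in>V. \<Sum>y'\<in>V. (\<Sum>x\<in>V. f x y * f x y')\<^sup>2)"

text \<open>Cauchy-Schwarz twice, first over \<open>A\<close> and then over
  \<open>B \<times> B\<close>. After each application the outer sum consists of squares and may be
  enlarged to all of \<open>V\<close>.\<close>

lemma discrepancy_le_box_norm:
  assumes "finite V" "A \<subseteq> V" "B \<subseteq> V"
  shows "(\<Sum>x\<in>A. \<Sum>y\<in>B. f x y) ^ 4 \<le> card V ^ 4 * box_norm f V"
proof -
  have fin: "finite A" "finite B" using assms finite_subset by auto
  have cards: "real (card A) \<le> card V" "real (card B) \<le> card V" using assms by (auto intro: card_mono)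
  define Z where "Z = (\<Sum>(y, y')\<in>B \<times> B. \<Sum>x\<in>V. f x y * f x y')"
  have "(\<Sum>x\<in>A. \<Sum>y\<in>B. f x y)\<^sup>2 \<le> (\<Sum>x\<in>A. (\<Sum>y\<in>B. f x y)\<^sup>2) * card A"
    by (rule sum_squared_le_sum_of_squares)
  also have "\<dots> \<le> (\<Sum>x\<in>V. (\<Sum>y\<in>B. f x y)\<^sup>2) * card V"
    using assms cards by (intro mult_mono sum_mono2 sum_nonneg) auto
  also have "(\<Sum>x\<in>V. (\<Sum>y\<in>B. f x y)\<^sup>2) = (\<Sum>x\<in>V. \<Sum>(y, y')\<in>B \<times> B. f x y * f x y')"
    by (simp add: power2_eq_square sum_product sum.cartesian_product)
  also have "\<dots> = Z" unfolding Z_def by (subst sum.swap) (simp add: case_prod_unfold)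
  finally have 1: "(\<Sum>x\<in>A. \<Sum>y\<in>B. f x y)\<^sup>2 \<le> Z * card V" .
  have "Z\<^sup>2 \<le> (\<Sum>(y, y')\<in>B \<times> B. (\<Sum>x\<in>V. f x y * f x y')\<^sup>2) * card (B \<times> B)"
    unfolding Z_def using sum_squared_le_sum_of_squares[of "\<lambda>(y, y'). \<Sum>x\<in>V. f x y * f x y'" "B \<times> B"]
    by (simp add: case_prod_unfold)
  also have "\<dots> \<le> (\<Sum>(y, y')\<in>V \<times> V. (\<Sum>x\<in>V. f x y * f x y')\<^sup>2) * (card V)\<^sup>2"
  proof (intro mult_mono sum_mono2 sum_nonneg)
    have "real (card B) * real (card B) \<le> real (card V) * real (card V)" using cards by (intro mult_mono) auto
    then show "real (card (B \<times> B)) \<le> real ((card V)\<^sup>2)" by (simp add: card_cartesian_product power2_eq_square)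
  qed (use assms in auto)
  also have "(\<Sum>(y, y')\<in>V \<times> V. (\<Sum>x\<in>V. f x y * f x y')\<^sup>2) = box_norm f V"
    by (simp add: box_norm_def sum.cartesian_product)
  finally have 2: "Z\<^sup>2 \<le> box_norm f V * (card V)\<^sup>2" by simp
  have "(\<Sum>x\<in>A. \<Sum>y\<in>B. f x y) ^ 4 = ((\<Sum>x\<in>A. \<Sum>y\<in>B. f x y)\<^sup>2)\<^sup>2" by simp
  also have "\<dots> \<le> (Z * card V)\<^sup>2" using 1 by (intro power_mono) auto
  also have "\<dots> = Z\<^sup>2 * (card V)\<^sup>2" by (simp add: power_mult_distrib)
  also have "\<dots> \<le> (box_norm f V * (card V)\<^sup>2) * (card V)\<^sup>2" using 2 by (intro mult_right_mono) auto
  also have "\<dots> = card V ^ 4 * box_norm f V" by (simp add: power4_eq_xxxx power2_eq_square)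
  finally show ?thesis .
qed

text \<open>The probability of \<open>G\<close> in the binomial random graph on the pairs
  \<open>P\<close>. Products of constants are used to fit the expansion of a product of
  sums.\<close>

definition graph_weight :: "real \<Rightarrow> 'a set \<Rightarrow> 'a set \<Rightarrow> real" where
  "graph_weight p P G = (\<Prod>e\<in>G. p) * (\<Prod>e\<in>P - G. 1 - p)"

lemma graph_weight_nonneg: "0 \<le> p \<Longrightarrow> p \<le> 1 \<Longrightarrow> 0 \<le> graph_weight p P G"
  by (simp add: graph_weight_def)

text \<open>Independence of the edges: the expectation of a product over edges is the product of the
  expectations.\<close>

lemma sum_graph_weight_prod:
  assumes "finite P"
  shows "(\<Sum>G\<in>Pow P. graph_weight p P G * (\<Prod>e\<in>P. \<phi> e (e \<in> G))) = (\<Prod>e\<in>P. p * \<phi> e True + (1 - p) * \<phi> e False)"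
  unfolding prod_add[OF assms]
proof (rule sum.cong)
  fix G assume "G \<in> Pow P"
  then have G: "G \<subseteq> P" "finite G" using assms finite_subset by auto
  have "(\<Prod>e\<in>P. \<phi> e (e \<in> G)) = (\<Prod>e\<in>P - G. \<phi> e (e \<in> G)) * (\<Prod>e\<in>G. \<phi> e (e \<in> G))"
    using G assms by (intro prod.subset_diff)
  also have "(\<Prod>e\<in>G. \<phi> e (e \<in> G)) = (\<Prod>e\<in>G. \<phi> e True)" by (intro prod.cong) auto
  also have "(\<Prod>e\<in>P - G. \<phi> e (e \<in> G)) = (\<Prod>e\<in>P - G. \<phi> e False)" by (intro prod.cong) auto
  finally show "graph_weight p P G * (\<Prod>e\<in>P. \<phi> e (e \<in> G)) =
      (\<Prod>e\<in>G. p * \<phi> e True) * (\<Prod>e\<in>P - G. (1 - p) * \<phi> e False)"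
    by (simp add: graph_weight_def prod.distrib mult_ac)
qed simp

lemma sum_graph_weight: "finite P \<Longrightarrow> (\<Sum>G\<in>Pow P. graph_weight p P G) = 1"
  using sum_graph_weight_prod[of P p "\<lambda>_ _. 1"] by simp

text \<open>A degenerate quadruple is bounded trivially by 1. Otherwise either some factor lies on
  the diagonal and vanishes, or the four pairs are distinct, hence independent with mean
  \<open>p * (1 - p) - (1 - p) * p = 0\<close>.\<close>

lemma sum_graph_weight_four_cycle:
  assumes V: "finite V" "x \<in> V" "x' \<in> V" "y \<in> V" "y' \<in> V" and p: "0 \<le> p" "p \<le> 1"
  shows "(\<Sum>G\<in>Pow (all_pairs V). graph_weight p (all_pairs V) G *
            (bias p G x y * bias p G x y' * (bias p G x' y * bias p G x' y'))) \<le> of_bool (x = x' \<or> y = y')"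
proof (cases "x = x' \<or> y = y'")
  case True
  let ?b = "\<lambda>G. bias p G x y * bias p G x y' * (bias p G x' y * bias p G x' y')"
  have "?b G \<le> 1" for G :: "'a set set"
  proof -
    have "\<bar>?b G\<bar> = \<bar>bias p G x y\<bar> * \<bar>bias p G x y'\<bar> * (\<bar>bias p G x' y\<bar> * \<bar>bias p G x' y'\<bar>)"
      by (simp only: abs_mult)
    also have "\<dots> \<le> 1 * 1 * (1 * 1)" using bias_bound[OF p] by (intro mult_mono) auto
    finally show ?thesis by simp
  qed
  then have "(\<Sum>G\<in>Pow (all_pairs V). graph_weight p (all_pairs V) G * ?b G)
    \<le> (\<Sum>G\<in>Pow (all_pairs V). graph_weight p (all_pairs V) G * 1)"
    using graph_weight_nonneg[OF p] by (intro sum_mono mult_left_mono) auto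
  also have "\<dots> = 1" using V by (simp add: sum_graph_weight)
  finally show ?thesis using True by simp
next
  case False
  show ?thesis
  proof (cases "x = y \<or> x = y' \<or> x' = y \<or> x' = y'")
    case True
    then have zero: "bias p G x y * bias p G x y' * (bias p G x' y * bias p G x' y') = 0" for G
      by (auto simp: bias_def)
    show ?thesis unfolding zero by simp
  next
    case ne: False
    define Q where "Q = {{x, y}, {x, y'}, {x', y}, {x', y'}}"
    have distinct: "{x, y} \<noteq> {x, y'}" "{x, y} \<noteq> {x', y}" "{x, y} \<noteq> {x', y'}"
      "{x, y'} \<noteq> {x', y}" "{x, y'} \<noteq> {x', y'}" "{x', y} \<noteq> {x', y'}"
      using False ne by (auto simp: doubleton_eq_iff)
    define \<phi> where "\<phi> e b = (if e \<in> Q then of_bool b - p else 1)" for e b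
    have Q: "Q \<subseteq> all_pairs V" using V ne by (auto simp: Q_def all_pairs_def)
    have prod: "bias p G x y * bias p G x y' * (bias p G x' y * bias p G x' y') = (\<Prod>e\<in>all_pairs V. \<phi> e (e \<in> G))" for G
    proof -
      have "(\<Prod>e\<in>all_pairs V. \<phi> e (e \<in> G)) = (\<Prod>e\<in>Q. \<phi> e (e \<in> G))"
        using Q V by (intro prod.mono_neutral_right) (auto simp: \<phi>_def)
      also have "\<dots> = (\<Prod>e\<in>Q. of_bool (e \<in> G) - p)" by (intro prod.cong) (auto simp: \<phi>_def)
      also have "\<dots> = (of_bool ({x, y} \<in> G) - p) * ((of_bool ({x, y'} \<in> G) - p) *
          ((of_bool ({x', y} \<in> G) - p) * (of_bool ({x', y'} \<in> G) - p)))"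
        unfolding Q_def by (simp add: distinct)
      finally show ?thesis using ne by (simp add: bias_def)
    qed
    have zero: "(\<Prod>e\<in>all_pairs V. p * \<phi> e True + (1 - p) * \<phi> e False) = 0"
      using V Q by (intro prod_zero bexI[of _ "{x, y}"]) (auto simp: \<phi>_def Q_def algebra_simps)
    show ?thesis unfolding prod sum_graph_weight_prod[OF finite_all_pairs[OF V(1)]] zero by simp
  qed
qed

text \<open>First moment: only quadruples with \<open>x = x'\<close> or \<open>y = y'\<close>
  contribute to the mean, and there are at most \<open>2 * card V ^ 3\<close> of them.\<close>

lemma exists_small_box_norm:
  assumes V: "finite V" and p: "0 \<le> p" "p \<le> 1"
  shows "\<exists>G\<subseteq>all_pairs V. box_norm (bias p G) V \<le> 2 * card V ^ 3"
proof (rule ccontr)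
  assume neg: "\<not> ?thesis"
  let ?W = "graph_weight p (all_pairs V)"
  have large: "2 * card V ^ 3 < box_norm (bias p G) V" if "G \<in> Pow (all_pairs V)" for G
    using neg that by (meson PowD not_le)
  have box: "box_norm (bias p G) V = (\<Sum>y\<in>V. \<Sum>y'\<in>V. \<Sum>x\<in>V. \<Sum>x'\<in>V.
      bias p G x y * bias p G x y' * (bias p G x' y * bias p G x' y'))" for G
    by (simp add: box_norm_def power2_eq_square sum_product)
  have "2 * card V ^ 3 = (\<Sum>G\<in>Pow (all_pairs V). ?W G * (2 * card V ^ 3))"
    using V by (simp add: sum_graph_weight flip: sum_distrib_right)
  also have "\<dots> < (\<Sum>G\<in>Pow (all_pairs V). ?W G * box_norm (bias p G) V)"
  proof (rule sum_strict_mono_ex1)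
    show "\<forall>G\<in>Pow (all_pairs V). ?W G * (2 * card V ^ 3) \<le> ?W G * box_norm (bias p G) V"
      using graph_weight_nonneg[OF p] large by (meson less_imp_le mult_left_mono)
    have "\<exists>G\<in>Pow (all_pairs V). ?W G > 0"
    proof (rule ccontr)
      assume "\<not> ?thesis"
      then have "(\<Sum>G\<in>Pow (all_pairs V). ?W G) \<le> 0" by (intro sum_nonpos) (meson not_le)
      then show False using V by (simp add: sum_graph_weight)
    qed
    then show "\<exists>G\<in>Pow (all_pairs V). ?W G * (2 * card V ^ 3) < ?W G * box_norm (bias p G) V"
      using large by (meson mult_strict_left_mono)
  qed (use V in simp)
  also have "\<dots> = (\<Sum>y\<in>V. \<Sum>y'\<in>V. \<Sum>x\<in>V. \<Sum>x'\<in>V. \<Sum>G\<in>Pow (all_pairs V).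
      ?W G * (bias p G x y * bias p G x y' * (bias p G x' y * bias p G x' y')))"
    unfolding box sum_distrib_left
    by (subst sum.swap, rule sum.cong[OF refl], subst sum.swap, rule sum.cong[OF refl],
        subst sum.swap, rule sum.cong[OF refl], rule sum.swap)
  also have "\<dots> \<le> (\<Sum>y\<in>V. \<Sum>y'\<in>V. \<Sum>x\<in>V. \<Sum>x'\<in>V. of_bool (x = x' \<or> y = y'))"
    using V p by (intro sum_mono sum_graph_weight_four_cycle) auto
  also have "\<dots> \<le> (\<Sum>y\<in>V. \<Sum>y'\<in>V. \<Sum>x\<in>V. \<Sum>x'\<in>V. of_bool (x' = x) + of_bool (y' = y))"
    by (intro sum_mono) auto
  also have "\<dots> = 2 * card V ^ 3"
    using V by (simp add: sum.distrib sum_of_bool_eq power3_eq_cube flip: sum_distrib_left sum_distrib_right)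
  finally show False by simp
qed

lemma exists_quasirandom_graph:
  assumes p: "0 \<le> p" "p \<le> 1" and \<delta>: "\<delta> > 0"
  shows "\<exists>N. \<forall>n\<ge>N. \<exists>G\<subseteq>all_pairs {..<n}. \<forall>A B. A \<subseteq> {..<n} \<longrightarrow> B \<subseteq> {..<n} \<longrightarrow>
      \<bar>\<Sum>x\<in>A. \<Sum>y\<in>B. bias p G x y\<bar> \<le> \<delta> * (real n)\<^sup>2"
proof (rule exI, intro allI impI)
  \<comment> \<open>This threshold turns the bound \<open>2 * n ^ 7\<close> on the fourth power of
    the discrepancy into \<open>\<delta> ^ 4 * n ^ 8\<close>.\<close>
  fix n :: nat assume n: "n \<ge> nat \<lceil>2 / \<delta> ^ 4\<rceil>"
  obtain G where G: "G \<subseteq> all_pairs {..<n}" "box_norm (bias p G) {..<n} \<le> 2 * n ^ 3"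
    using exists_small_box_norm[of "{..<n}" p] p by auto
  have "2 / \<delta> ^ 4 \<le> n" using n by linarith
  then have n': "2 \<le> \<delta> ^ 4 * n" using \<delta> by (simp add: field_simps)
  have "\<bar>\<Sum>x\<in>A. \<Sum>y\<in>B. bias p G x y\<bar> \<le> \<delta> * (real n)\<^sup>2" if "A \<subseteq> {..<n}" "B \<subseteq> {..<n}" for A B
  proof -
    have "\<bar>\<Sum>x\<in>A. \<Sum>y\<in>B. bias p G x y\<bar> ^ 4 \<le> real n ^ 4 * box_norm (bias p G) {..<n}"
      using discrepancy_le_box_norm[of "{..<n}" A B "bias p G"] that by (simp add: power_even_abs)
    also have "\<dots> \<le> real n ^ 4 * (2 * n ^ 3)" using G by (intro mult_left_mono) auto
    also have "\<dots> = real n ^ 7 * 2" by (simp add: power_add[symmetric])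
    also have "\<dots> \<le> real n ^ 7 * (\<delta> ^ 4 * n)" using n' by (intro mult_left_mono) auto
    also have "\<dots> = (\<delta> * (real n)\<^sup>2) ^ 4" 
      using power_Suc2[of "real n" 7] by (simp add: power_mult_distrib flip: power_mult)
    finally show ?thesis using \<delta> by (subst (asm) power_mono_iff) auto
  qed
  with G show "\<exists>G\<subseteq>all_pairs {..<n}. \<forall>A B. A \<subseteq> {..<n} \<longrightarrow> B \<subseteq> {..<n} \<longrightarrow>
      \<bar>\<Sum>x\<in>A. \<Sum>y\<in>B. bias p G x y\<bar> \<le> \<delta> * (real n)\<^sup>2" by blast
qed

section \<open>Upper bounds for the distance\<close>

lemma card_all_pairs:
  assumes "finite V"
  shows "card (all_pairs V) = card V choose 2"
proof -
  have "all_pairs V = {e. e \<subseteq> V \<and> card e = 2}"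
    unfolding all_pairs_def card_2_iff by blast
  then show ?thesis using n_subsets[OF assms, of 2] by simp
qed

text \<open>Greedy colouring: a new vertex takes the colour that makes the fewest of its edges to
  the earlier vertices monochromatic, at most a third of them.\<close>

lemma three_colouring_few_monochromatic:
  assumes "finite V" "E \<subseteq> all_pairs V"
  shows "\<exists>c. (\<forall>x. c x < (3::nat)) \<and> 3 * card {e \<in> E. \<forall>x\<in>e. \<forall>y\<in>e. c x = c y} \<le> card E"
  using assms
proof (induction V arbitrary: E rule: finite_induct)
  case empty
  then have "E = {}" by (auto simp: all_pairs_def)
  then show ?case by (intro exI[of _ "\<lambda>_. 0"]) auto
next
  case (insert v V)
  have finE: "finite E" using insert.prems insert.hyps finite_subset[OF insert.prems] by simp
  define E0 where "E0 = {e \<in> E. v \<notin> e}"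
  define E1 where "E1 = {e \<in> E. v \<in> e}"
  have E: "E = E0 \<union> E1" "E0 \<inter> E1 = {}" "finite E0" "finite E1" using finE by (auto simp: E0_def E1_def)
  have "E0 \<subseteq> all_pairs V" using insert.prems by (fastforce simp: E0_def all_pairs_def)
  then obtain c where c: "\<And>x. c x < (3::nat)" "3 * card {e \<in> E0. \<forall>x\<in>e. \<forall>y\<in>e. c x = c y} \<le> card E0"
    using insert.IH by blast
  \<comment> \<open>The edges that become monochromatic if \<open>v\<close> receives colour
    \<open>r\<close>.\<close>
  define B where "B r = {e \<in> E1. \<forall>x\<in>e - {v}. c x = r}" for r
  have "card (B 0) + card (B 1) + card (B 2) \<le> card E1"
  proof -
    have ex: "\<exists>x. x \<in> e - {v}" if "e \<in> E1" for e
      using that insert.prems by (force simp: E1_def all_pairs_def)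
    have disj: "B r \<inter> B r' = {}" if "r \<noteq> r'" for r r'
    proof (rule ccontr)
      assume "B r \<inter> B r' \<noteq> {}"
      then obtain e where "e \<in> B r" "e \<in> B r'" by blast
      then show False using ex[of e] that by (auto simp: B_def)
    qed
    have "card (B 0) + card (B 1) + card (B 2) = card (B 0 \<union> B 1 \<union> B 2)"
      using E(4) disj[of 0 1] disj[of 0 2] disj[of 1 2]
      by (subst card_Un_disjoint; (subst card_Un_disjoint)?) (auto simp: B_def)
    also have "\<dots> \<le> card E1" using E(4) by (intro card_mono) (auto simp: B_def)
    finally show ?thesis .
  qed
  then have "3 * card (B 0) \<le> card E1 \<or> 3 * card (B 1) \<le> card E1 \<or> 3 * card (B 2) \<le> card E1" by linarith
  moreover have "0 < (3::nat)" "1 < (3::nat)" "2 < (3::nat)" by simp_all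
  ultimately obtain r where r: "r < 3" "3 * card (B r) \<le> card E1" by blast
  define c' where "c' = c(v := r)"
  have "{e \<in> E. \<forall>x\<in>e. \<forall>y\<in>e. c' x = c' y} \<subseteq> {e \<in> E0. \<forall>x\<in>e. \<forall>y\<in>e. c x = c y} \<union> B r"
  proof
    fix e assume e: "e \<in> {e \<in> E. \<forall>x\<in>e. \<forall>y\<in>e. c' x = c' y}"
    show "e \<in> {e \<in> E0. \<forall>x\<in>e. \<forall>y\<in>e. c x = c y} \<union> B r"
    proof (cases "v \<in> e")
      case True
      have "c x = r" if "x \<in> e - {v}" for x
      proof -
        have "c' x = c' v" using e True that by blast
        then show ?thesis using that by (simp add: c'_def)
      qed
      moreover have "e \<in> E1" using e True unfolding E1_def by blast
      ultimately show ?thesis unfolding B_def by blast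
    next
      case False
      have same: "c' x = c x" if "x \<in> e" for x using that False by (auto simp: c'_def)
      have "c x = c y" if "x \<in> e" "y \<in> e" for x y
        using e that same[of x] same[of y] by (metis (mono_tags, lifting) mem_Collect_eq)
      moreover have "e \<in> E0" using e False unfolding E0_def by blast
      ultimately show ?thesis by blast
    qed
  qed
  then have "card {e \<in> E. \<forall>x\<in>e. \<forall>y\<in>e. c' x = c' y} \<le> card ({e \<in> E0. \<forall>x\<in>e. \<forall>y\<in>e. c x = c y} \<union> B r)"
    using E by (intro card_mono) (auto simp: B_def)
  also have "\<dots> \<le> card {e \<in> E0. \<forall>x\<in>e. \<forall>y\<in>e. c x = c y} + card (B r)" by (rule card_Un_le)
  finally have "3 * card {e \<in> E. \<forall>x\<in>e. \<forall>y\<in>e. c' x = c' y} \<le> card E0 + card E1"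
    using c(2) r(2) by linarith
  also have "\<dots> = card E" using E by (simp add: card_Un_disjoint)
  finally show ?case using c(1) r(1) by (intro exI[of _ c']) (auto simp: c'_def)
qed

lemma finite_gdists: "finite V \<Longrightarrow> finite {gdist V E E' | E'. E' \<subseteq> all_pairs V \<and> word_representable V E'}"
  by (rule finite_subset[of _ "gdist V E ` Pow (all_pairs V)"]) auto

lemma dist_word_le_gdist:
  "finite V \<Longrightarrow> E' \<subseteq> all_pairs V \<Longrightarrow> word_representable V E' \<Longrightarrow> dist_word V E \<le> gdist V E E'"
  unfolding dist_word_def by (intro Min_le finite_gdists) auto

lemma dist_word_attained:
  assumes "finite V"
  obtains E' where "E' \<subseteq> all_pairs V" "word_representable V E'" "dist_word V E = gdist V E E'"
proof -
  have "dist_word V E \<in> {gdist V E E' | E'. E' \<subseteq> all_pairs V \<and> word_representable V E'}"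
    unfolding dist_word_def using word_representable_complete[OF assms]
    by (intro Min_in finite_gdists assms) auto
  then show thesis using that by blast
qed

lemma dist_word_le_third:
  assumes "finite V" "E \<subseteq> all_pairs V"
  shows "dist_word V E \<le> real (card E) / real (card V choose 2) / 3"
proof -
  obtain c where c: "\<And>x. c x < (3::nat)" "3 * card {e \<in> E. \<forall>x\<in>e. \<forall>y\<in>e. c x = c y} \<le> card E"
    using three_colouring_few_monochromatic[OF assms] by blast
  define M where "M = {e \<in> E. \<forall>x\<in>e. \<forall>y\<in>e. c x = c y}"
  have "word_representable V (E - M)"
  proof (rule word_representable_three_colourable)
    fix x y assume "{x, y} \<in> E - M"
    then show "c x \<noteq> c y" by (auto simp: M_def)
  qed (use assms c in auto)
  then have "dist_word V E \<le> gdist V E (E - M)" using assms by (intro dist_word_le_gdist) auto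
  also have "E - (E - M) \<union> (E - M - E) = M" by (auto simp: M_def)
  then have "gdist V E (E - M) = real (card M) / real (card V choose 2)" by (simp add: gdist_def)
  also have "\<dots> \<le> (real (card E) / 3) / real (card V choose 2)"
    using c(2) by (intro divide_right_mono) (simp_all add: M_def)
  finally show ?thesis by simp
qed

lemma dist_word_le_complement:
  assumes "finite V" "E \<subseteq> all_pairs V" "card V \<ge> 2"
  shows "dist_word V E \<le> 1 - real (card E) / real (card V choose 2)"
proof -
  have N: "real (card V choose 2) > 0" using assms by simp
  have "dist_word V E \<le> gdist V E (all_pairs V)"
    using assms word_representable_complete by (intro dist_word_le_gdist) auto
  also have "E - all_pairs V \<union> (all_pairs V - E) = all_pairs V - E" using assms by auto
  then have "gdist V E (all_pairs V) = real (card (all_pairs V - E)) / real (card V choose 2)" by (simp add: gdist_def)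
  also have "card (all_pairs V - E) = card (all_pairs V) - card E"
    using assms finite_subset[OF assms(2)] by (intro card_Diff_subset) auto
  also have "real \<dots> = real (card V choose 2) - real (card E)"
    using assms by (subst of_nat_diff) (auto intro: card_mono simp: card_all_pairs[symmetric])
  finally show ?thesis using N by (simp add: diff_divide_distrib)
qed

lemma dist_word_edit:
  assumes "finite V" "G \<subseteq> all_pairs V" "G' \<subseteq> all_pairs V"
  shows "dist_word V G \<le> dist_word V G' + gdist V G G'"
proof -
  obtain H where H: "H \<subseteq> all_pairs V" "word_representable V H" "dist_word V G' = gdist V G' H"
    using dist_word_attained[OF assms(1)] by blast
  have fin: "finite G" "finite G'" "finite H"
    using assms H(1) finite_all_pairs[OF assms(1)] finite_subset by metis+
  have "card (G - H \<union> (H - G)) \<le> card ((G' - H \<union> (H - G')) \<union> (G - G' \<union> (G' - G)))"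
    using fin by (intro card_mono) auto
  also have "\<dots> \<le> card (G' - H \<union> (H - G')) + card (G - G' \<union> (G' - G))" by (rule card_Un_le)
  finally have "gdist V G H \<le> gdist V G' H + gdist V G G'"
    unfolding gdist_def add_divide_distrib[symmetric] by (intro divide_right_mono) simp_all
  then show ?thesis using dist_word_le_gdist[OF assms(1) H(1,2), of G] H(3) by simp
qed

section \<open>Sums over pairs of indices\<close>

lemma pairs_below_Suc: "pairs_below (Suc k) = pairs_below k \<union> (\<lambda>i. (i, k)) ` {..<k}"
  by (auto simp: pairs_below_def less_Suc_eq)

lemma sum_pairs_below_Suc:
  "(\<Sum>(i, j)\<in>pairs_below (Suc k). f i j) = (\<Sum>(i, j)\<in>pairs_below k. f i j) + (\<Sum>i<k. f i k)"
proof -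
  have "(\<Sum>(i, j)\<in>(\<lambda>i. (i, k)) ` {..<k}. f i j) = (\<Sum>i<k. f i k)"
    by (subst sum.reindex) (auto intro: inj_onI)
  then show ?thesis unfolding pairs_below_Suc
    by (subst sum.union_disjoint) (auto simp: pairs_below_def finite_pairs_below[unfolded pairs_below_def])
qed

lemma sum_pairs_below_symmetric:
  fixes f :: "nat \<Rightarrow> nat \<Rightarrow> real"
  assumes "\<And>i j. f i j = f j i" "\<And>i. f i i = 0"
  shows "(\<Sum>i<k. \<Sum>j<k. f i j) = 2 * (\<Sum>(i, j)\<in>pairs_below k. f i j)"
proof (induction k)
  case (Suc k)
  have "(\<Sum>j<k. f k j) = (\<Sum>i<k. f i k)" by (intro sum.cong refl assms)
  then show ?case using Suc by (simp add: sum_pairs_below_Suc sum.distrib assms(2))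
qed (simp add: pairs_below_def)

lemma card_pairs_below: "real (card (pairs_below k)) = real k * (real k - 1) / 2"
proof -
  have "real (card (pairs_below k)) = (\<Sum>(i, j)\<in>pairs_below k. 1)" by simp
  also have "\<dots> = real k * (real k - 1) / 2"
    by (induction k) (simp add: pairs_below_def, simp only: sum_pairs_below_Suc, simp add: field_simps)
  finally show ?thesis .
qed

lemma choose_two_real: "real (n choose 2) = real n * (real n - 1) / 2"
  by (cases n) (simp_all add: choose_two real_of_nat_div field_simps)

section \<open>Graphs far from word-representable\<close>

text \<open>The parts have the common size \<open>s\<close>, and fewer than \<open>k\<close>
  vertices are left over. Since \<open>4 * k \<le> s\<close>, rounding adds only
  \<open>k * s\<^sup>2\<close> to \<open>k\<^sup>2 * s\<^sup>2\<close>, that is, a term linear in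
  \<open>k\<close> when measured in units of \<open>s\<^sup>2\<close>.\<close>

lemma interval_bounds:
  fixes n k :: nat
  assumes "2 \<le> k" "4 * k\<^sup>2 \<le> n"
  defines "s \<equiv> n div k"
  shows "real n \<le> 2 * real k * real s" "(real n)\<^sup>2 \<le> (real k ^ 2 + real k) * (real s)\<^sup>2" "s > 0" "k * s \<le> n"
proof -
  have "4 * k * k \<le> n" using assms by (simp add: power2_eq_square)
  then have s: "4 * k \<le> s" unfolding s_def using assms by (simp add: less_eq_div_iff_mult_less_eq)
  then show "s > 0" using assms by linarith
  have "n mod k < k" using assms by simp
  moreover have "n = k * s + n mod k" by (simp add: s_def)
  ultimately have "n \<le> k * s + k" by linarith
  then have n: "real n \<le> real k * (real s + 1)" by (metis distrib_left mult.right_neutral of_nat_1 of_nat_add of_nat_le_iff of_nat_mult)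
  also have "\<dots> \<le> real k * (2 * real s)" using s assms by (intro mult_left_mono) linarith+
  finally show "real n \<le> 2 * real k * real s" by simp
  have "(real n)\<^sup>2 \<le> (real k * (real s + 1))\<^sup>2" using n by (intro power_mono) auto
  also have "\<dots> = real k ^ 2 * (real s)\<^sup>2 + real k * (real k * (2 * real s + 1))"
    by (simp add: power2_eq_square algebra_simps)
  also have "real k * (real k * (2 * real s + 1)) \<le> real k * (real s * real s)"
  proof -
    have "4 * real k \<le> real s" using s by linarith
    then have "real k * (2 * real s + 1) \<le> (real s / 4) * (2 * real s + 1)" by (intro mult_right_mono) auto
    also have "\<dots> \<le> (real s / 4) * (4 * real s)" using s assms by (intro mult_left_mono) auto
    finally have "real k * (2 * real s + 1) \<le> real s * real s" by simp
    then show ?thesis by (intro mult_left_mono) auto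
  qed
  finally show "(real n)\<^sup>2 \<le> (real k ^ 2 + real k) * (real s)\<^sup>2"
    by (simp add: power2_eq_square algebra_simps)
  show "k * s \<le> n" by (simp add: s_def)
qed

text \<open>Blocks of \<open>s\<close> consecutive ranks in the order of \<open>pos\<close>; in the
  proof \<open>v m\<close> is the vertex of rank \<open>m\<close>.\<close>

lemma ordered_intervals:
  fixes pos :: "nat \<Rightarrow> nat"
  assumes inj: "inj_on pos {..<n}" and ks: "k * s \<le> n" and s: "s > 0"
  obtains I where "\<forall>i<k. I i \<subseteq> {..<n} \<and> card (I i) = s"
    "\<forall>i j. \<forall>x\<in>I i. \<forall>y\<in>I j. i < j \<longrightarrow> j < k \<longrightarrow> pos x < pos y"
proof -
  define ps where "ps = sorted_list_of_set (pos ` {..<n})"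
  have len: "length ps = n" using inj by (simp add: ps_def card_image)
  have set: "set ps = pos ` {..<n}" by (simp add: ps_def)
  have mono: "ps ! a < ps ! b" if "a < b" "b < n" for a b
    using that len sorted_list_of_set.strict_sorted_key_list_of_set[of "pos ` {..<n}"] by (simp add: ps_def sorted_wrt_nth_less)
  define v where "v m = the_inv_into {..<n} pos (ps ! m)" for m
  have v: "v m \<in> {..<n}" "pos (v m) = ps ! m" if "m < n" for m
  proof -
    have "ps ! m \<in> pos ` {..<n}" using that len set nth_mem by metis
    then show "v m \<in> {..<n}" "pos (v m) = ps ! m"
      unfolding v_def using the_inv_into_into[OF inj _ order_refl] f_the_inv_into_f[OF inj] by blast+
  qed
  have injv: "inj_on v {..<n}"
  proof (rule inj_onI)
    fix a b assume ab: "a \<in> {..<n}" "b \<in> {..<n}" "v a = v b"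
    then have "ps ! a = ps ! b" using v by (metis lessThan_iff)
    then show "a = b" using mono[of a b] mono[of b a] ab by (metis lessThan_iff less_irrefl linorder_neqE_nat)
  qed
  define I where "I i = v ` {i * s..<Suc i * s}" for i
  have le: "Suc i * s \<le> n" if "i < k" for i
    using ks mult_le_mono1[of "Suc i" k s] that by linarith
  show thesis
  proof (rule that; intro allI ballI impI)
    fix i assume "i < k"
    then have sub: "{i * s..<Suc i * s} \<subseteq> {..<n}" using le[of i] by auto
    then have "inj_on v {i * s..<Suc i * s}" using injv inj_on_subset by blast
    then have "card (I i) = s" unfolding I_def by (simp add: card_image)
    then show "I i \<subseteq> {..<n} \<and> card (I i) = s" using sub v unfolding I_def by blast
  next
    fix i j x y assume "x \<in> I i" "y \<in> I j" and ij: "i < j" "j < k"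
    then obtain a b where ab: "x = v a" "y = v b" "a < Suc i * s" "j * s \<le> b" "b < Suc j * s" by (auto simp: I_def)
    have "Suc i * s \<le> j * s" using ij by (intro mult_le_mono1) simp
    then have "a < b" "b < n" using ab le[OF ij(2)] by linarith+
    then show "pos x < pos y" using v[of a] v[of b] mono[of a b] ab by simp
  qed
qed

text \<open>No edge is counted twice: \<open>pos\<close> tells which end comes first, and a vertex
  in two parts would have to precede itself.\<close>

lemma sum_cross_edges_le:
  fixes pos :: "nat \<Rightarrow> nat" and I :: "nat \<Rightarrow> nat set"
  assumes D: "finite D" and I: "\<And>i. i < k \<Longrightarrow> finite (I i)"
    and pos: "\<And>i j x y. i < j \<Longrightarrow> j < k \<Longrightarrow> x \<in> I i \<Longrightarrow> y \<in> I j \<Longrightarrow> pos x < pos y"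
  shows "(\<Sum>(i, j)\<in>pairs_below k. \<Sum>x\<in>I i. \<Sum>y\<in>I j. of_bool ({x, y} \<in> D)) \<le> real (card D)"
proof -
  let ?T = "SIGMA p:pairs_below k. I (fst p) \<times> I (snd p)"
  have fin: "finite ?T" using I by (intro finite_SigmaI finite_pairs_below) (auto simp: pairs_below_def)
  let ?e = "\<lambda>t :: (nat \<times> nat) \<times> nat \<times> nat. {fst (snd t), snd (snd t)}"
  have "(\<Sum>(i, j)\<in>pairs_below k. \<Sum>x\<in>I i. \<Sum>y\<in>I j. of_bool ({x, y} \<in> D) :: real) =
    (\<Sum>p\<in>pairs_below k. \<Sum>q\<in>I (fst p) \<times> I (snd p). of_bool ({fst q, snd q} \<in> D))"
    by (simp add: sum.cartesian_product case_prod_unfold)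
  also have "\<dots> = (\<Sum>(p, q)\<in>?T. of_bool ({fst q, snd q} \<in> D))"
    using I by (intro sum.Sigma finite_pairs_below) (auto simp: pairs_below_def)
  also have "\<dots> = (\<Sum>t\<in>?T. of_bool (?e t \<in> D))"
    by (simp add: case_prod_unfold)
  also have "\<dots> = real (card (?T \<inter> {t. ?e t \<in> D}))" using fin by (simp add: sum_of_bool_eq)
  also have "card (?T \<inter> {t. ?e t \<in> D}) \<le> card D"
  proof (rule card_inj_on_le[of ?e])
    show "inj_on ?e (?T \<inter> {t. ?e t \<in> D})"
    proof (rule inj_onI)
      fix t t' assume t: "t \<in> ?T \<inter> {t. ?e t \<in> D}" "t' \<in> ?T \<inter> {t. ?e t \<in> D}" "?e t = ?e t'"
      obtain i j x y i' j' x' y' where tt: "t = ((i, j), x, y)" "t' = ((i', j'), x', y')"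
        by (metis prod.collapse)
      have m: "i < j" "j < k" "x \<in> I i" "y \<in> I j" "i' < j'" "j' < k" "x' \<in> I i'" "y' \<in> I j'"
        using t by (auto simp: tt pairs_below_def)
      have "pos x < pos y" "pos x' < pos y'" using pos m by blast+
      then have eq: "x = x'" "y = y'" using t(3) by (auto simp: tt doubleton_eq_iff)
      have uniq: "a = b" if "a < k" "b < k" "z \<in> I a" "z \<in> I b" for a b z
        using pos[of a b z z] pos[of b a z z] that by (metis less_irrefl linorder_neqE_nat)
      have "i = i'" using m eq by (intro uniq[of i i' x]) auto
      moreover have "j = j'" using m eq by (intro uniq[of j j' y]) auto
      ultimately show "t = t'" using eq by (simp add: tt)
    qed
  qed (use D in auto)
  finally show ?thesis by simp
qed

text \<open>Each pair of parts is white, gray or black according to the density of \<open>H\<close>. Editing \<open>G\<close> into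
  \<open>H\<close> costs about \<open>p\<close> on a white pair and \<open>1 - p\<close> on a black one; both are at least
  \<open>\<mu> - \<mu> * (gray - 2 * white)\<close> for \<open>\<mu> = min (p / 3) (1 - p)\<close>, and the correction sums to at most \<open>k\<close>.\<close>

lemma regular_tuple_cost:
  fixes pos :: "nat \<Rightarrow> nat" and X :: "nat \<Rightarrow> nat set" and p \<delta> \<tau> :: real
  assumes p: "0 \<le> p" "p \<le> 1" and \<delta>: "0 < \<delta>" "\<delta> \<le> 1" and \<tau>: "0 \<le> \<tau>"
    and fin: "\<And>i. i < k \<Longrightarrow> finite (X i) \<and> X i \<noteq> {}"
    and pos: "\<And>i j x y. i < j \<Longrightarrow> j < k \<Longrightarrow> x \<in> X i \<Longrightarrow> y \<in> X j \<Longrightarrow> pos x < pos y"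
    and H: "\<And>a b c d. a \<in> \<Union>(X ` {..<k}) \<Longrightarrow> b \<in> \<Union>(X ` {..<k}) \<Longrightarrow> c \<in> \<Union>(X ` {..<k}) \<Longrightarrow> d \<in> \<Union>(X ` {..<k}) \<Longrightarrow>
       pos a < pos b \<Longrightarrow> pos b < pos c \<Longrightarrow> pos c < pos d \<Longrightarrow>
       {a, b} \<in> H \<Longrightarrow> {b, c} \<in> H \<Longrightarrow> {c, d} \<in> H \<Longrightarrow> {a, d} \<in> H \<Longrightarrow> {a, c} \<in> H \<and> {b, d} \<in> H"
    and h_def: "h = (\<lambda>x y. of_bool ({x, y} \<in> H) :: real)"
    and d_def: "d = (\<lambda>x y. of_bool ({x, y} \<in> G - H \<union> (H - G)) :: real)"
    and reg: "\<And>i j A B. i < j \<Longrightarrow> j < k \<Longrightarrow> A \<subseteq> X i \<Longrightarrow> B \<subseteq> X j \<Longrightarrow> \<delta> / 2 * card (X i) \<le> card A \<Longrightarrow>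
        \<delta> / 2 * card (X j) \<le> card B \<Longrightarrow> \<bar>density h A B - density h (X i) (X j)\<bar> < \<delta>"
    and bias: "\<And>i j. i < j \<Longrightarrow> j < k \<Longrightarrow> \<bar>\<Sum>x\<in>X i. \<Sum>y\<in>X j. bias p G x y\<bar> \<le> \<tau> * (card (X i) * card (X j))"
  shows "real (card (pairs_below k)) * (min (p / 3) (1 - p) - 2 * \<delta> - \<tau>) - real k
    \<le> (\<Sum>(i, j)\<in>pairs_below k. density d (X i) (X j))"
proof -
  define \<mu> where "\<mu> = min (p / 3) (1 - p)"
  have \<mu>: "0 \<le> \<mu>" "\<mu> \<le> 1" "3 * \<mu> \<le> p" "\<mu> \<le> 1 - p" using p by (auto simp: \<mu>_def min_def)
  \<comment> \<open>Regularity loses less than \<open>\<delta>\<close>, so the threshold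
    \<open>2 * \<delta>\<close> leaves density at least \<open>\<delta>\<close> on all large
    subsets.\<close>
  define S where "S i j \<longleftrightarrow> 2 * \<delta> \<le> density h (X i) (X j)" for i j
  define Gr where "Gr i j \<longleftrightarrow> S i j \<and> density h (X i) (X j) \<le> 1 - 2 * \<delta>" for i j
  have hsym: "h x y = h y x" for x y by (simp add: h_def insert_commute)
  have h01: "h x y = 0 \<or> h x y = 1" for x y by (simp add: h_def)
  have dsym: "density h A B = density h B A" for A B
    unfolding density_flip[of h A] by (simp add: hsym)
  have lreg: "lower_regular (\<delta> / 2) \<delta> h (X i) (X j)" if ij: "i \<noteq> j" "i < k" "j < k" "S i j" for i j
  proof -
    have *: "lower_regular (\<delta> / 2) \<delta> h (X i) (X j)" if ij: "i < j" "j < k" "S i j" for i j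
      unfolding lower_regular_def
    proof (intro allI impI)
      fix A B assume AB: "A \<subseteq> X i" "B \<subseteq> X j" "\<delta> / 2 * card (X i) \<le> card A" "\<delta> / 2 * card (X j) \<le> card B"
      have "density h A B \<ge> \<delta>" using reg[OF ij(1,2) AB] ij(3) unfolding S_def by linarith
      moreover have "(\<Sum>x\<in>A. \<Sum>y\<in>B. h x y) = density h A B * (card A * card B)"
        using \<delta> AB fin[of i] fin[of j] ij
        by (cases "card A = 0 \<or> card B = 0") (auto simp: density_def dest: finite_subset)
      ultimately show "\<delta> * card A * card B \<le> (\<Sum>x\<in>A. \<Sum>y\<in>B. h x y)"
        by (simp add: mult.assoc mult_right_mono)
    qed
    show ?thesis
    proof (cases "i < j")
      case False
      then have "j < i" using ij by simp
      moreover have "S j i" using ij dsym by (simp add: S_def)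
      ultimately show ?thesis using *[of j i] ij lower_regular_commute[of h, OF hsym] by blast
    qed (use * ij in blast)
  qed
  \<comment> \<open>The indices are in cyclic order with \<open>a\<close> opposite to
    \<open>c\<close>, not sorted; so the same fact serves for either diagonal of a sorted
    quadruple.\<close>
  have four: "\<exists>u\<in>X a. \<exists>v\<in>X b. \<exists>w\<in>X c. \<exists>z\<in>X d.
      {u, v} \<in> H \<and> {u, z} \<in> H \<and> {v, w} \<in> H \<and> {w, z} \<in> H \<and> {u, w} \<notin> H"
    if "a < k" "b < k" "c < k" "d < k" "distinct [a, b, c, d]" "S a b" "S a d" "S c b" "S c d" "Gr a c" for a b c d
  proof -
    have "(\<Sum>x\<in>X a. \<Sum>y\<in>X c. h x y) \<le> (1 - 2 * \<delta>) * card (X a) * card (X c)"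
    proof -
      have "density h (X a) (X c) \<le> 1 - 2 * \<delta>" using that by (simp add: Gr_def)
      moreover have "0 < real (card (X a) * card (X c))" using fin that by (simp add: card_gt_0_iff)
      ultimately show ?thesis unfolding density_def by (simp add: divide_le_eq mult.assoc)
    qed
    then have "\<exists>u\<in>X a. \<exists>v\<in>X b. \<exists>w\<in>X c. \<exists>z\<in>X d. h u v = 1 \<and> h u z = 1 \<and> h w v = 1 \<and> h w z = 1 \<and> h u w = 0"
      using that fin \<delta> h01 by (intro four_cycle_with_missing_diagonal[where \<delta> = \<delta>] lreg) auto
    then show ?thesis by (auto simp: h_def insert_commute)
  qed
  define \<phi> where "\<phi> i j = (if i = j then 0 else of_bool (Gr i j) - 2 * of_bool (\<not> S i j) :: real)" for i j
  have "(\<Sum>i<k. \<Sum>j<k. \<phi> i j) \<le> 2 * real (card {..<k})"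
    unfolding \<phi>_def
  proof (rule gray_le_twice_white)
    fix a b c d assume V: "{a, b, c, d} \<subseteq> {..<k}" and lt: "a < b" "b < c" "c < d"
      and S: "S a b" "S b c" "S c d" "S a d"
    have S': "S b a" "S c b" "S d c" "S d a" using S dsym by (simp_all add: S_def)
    have U: "x \<in> \<Union>(X ` {..<k})" if "x \<in> X i" "i \<in> {a, b, c, d}" for x i using that V by blast
    have "\<not> Gr a c"
    proof
      assume "Gr a c"
      then obtain u v w z where m: "u \<in> X a" "v \<in> X b" "w \<in> X c" "z \<in> X d"
        "{u, v} \<in> H" "{u, z} \<in> H" "{v, w} \<in> H" "{w, z} \<in> H" "{u, w} \<notin> H"
        using four[of a b c d] V lt S S' by auto
      then show False using H[of u v w z] U pos[of a b u v] pos[of b c v w] pos[of c d w z] lt V by auto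
    qed
    moreover have "\<not> Gr b d"
    proof
      assume "Gr b d"
      then obtain u v w z where m: "u \<in> X b" "v \<in> X a" "w \<in> X d" "z \<in> X c"
        "{u, v} \<in> H" "{u, z} \<in> H" "{v, w} \<in> H" "{w, z} \<in> H" "{u, w} \<notin> H"
        using four[of b a d c] V lt S S' by auto
      then show False using H[of v u z w] U pos[of a b v u] pos[of b c u z] pos[of c d z w] lt V
        by (auto simp: insert_commute)
    qed
    ultimately show "\<not> Gr a c \<and> \<not> Gr b d" ..
  qed (auto simp: Gr_def S_def dsym)
  moreover have "(\<Sum>i<k. \<Sum>j<k. \<phi> i j) = 2 * (\<Sum>(i, j)\<in>pairs_below k. \<phi> i j)"
    by (rule sum_pairs_below_symmetric) (auto simp: \<phi>_def Gr_def S_def dsym)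
  ultimately have \<phi>: "(\<Sum>(i, j)\<in>pairs_below k. \<phi> i j) \<le> real k" by simp
  have point: "(\<mu> - 2 * \<delta> - \<tau>) - \<mu> * \<phi> i j \<le> density d (X i) (X j)" if ij: "i < j" "j < k" for i j
  proof -
    define a where "a = real (card (X i)) * real (card (X j))"
    have a: "a > 0" using fin ij by (simp add: a_def card_gt_0_iff)
    define Sb where "Sb = (\<Sum>x\<in>X i. \<Sum>y\<in>X j. bias p G x y)"
    define Sd where "Sd = (\<Sum>x\<in>X i. \<Sum>y\<in>X j. d x y)"
    define Sh where "Sh = (\<Sum>x\<in>X i. \<Sum>y\<in>X j. h x y)"
    have Sb: "\<bar>Sb\<bar> \<le> \<tau> * a" using bias[OF ij] by (simp add: Sb_def a_def)
    \<comment> \<open>The edit indicator is the absolute difference of the two adjacency indicators,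
      and that of \<open>G\<close> is \<open>bias p G x y + p\<close> because \<open>x\<close> and
      \<open>y\<close> are distinct.\<close>
    have pw: "bias p G x y + p - h x y \<le> d x y" "h x y - bias p G x y - p \<le> d x y" if "x \<in> X i" "y \<in> X j" for x y
    proof -
      have "x \<noteq> y" using pos[OF ij that] by auto
      then show "bias p G x y + p - h x y \<le> d x y" "h x y - bias p G x y - p \<le> d x y"
        by (auto simp: bias_def h_def d_def)
    qed
    have "(\<Sum>x\<in>X i. \<Sum>y\<in>X j. bias p G x y + p - h x y) \<le> Sd"
      unfolding Sd_def by (intro sum_mono pw)
    then have 1: "Sb + p * a - Sh \<le> Sd"
      by (simp add: sum.distrib sum_subtractf Sb_def Sh_def a_def mult_ac)
    have "(\<Sum>x\<in>X i. \<Sum>y\<in>X j. h x y - bias p G x y - p) \<le> Sd"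
      unfolding Sd_def by (intro sum_mono pw)
    then have 2: "Sh - Sb - p * a \<le> Sd"
      by (simp add: sum.distrib sum_subtractf Sb_def Sh_def a_def mult_ac)
    have 3: "0 \<le> Sd" unfolding Sd_def by (intro sum_nonneg) (simp add: d_def)
    have dens: "density d (X i) (X j) = Sd / a" "density h (X i) (X j) = Sh / a"
      by (simp_all add: density_def Sd_def Sh_def a_def)
    have "((\<mu> - 2 * \<delta> - \<tau>) - \<mu> * \<phi> i j) * a \<le> Sd"
    proof -
      \<comment> \<open>White, gray, black: the required costs are \<open>3 * \<mu>\<close>, 0 and
        \<open>\<mu>\<close>, up to the error \<open>2 * \<delta> + \<tau>\<close>.\<close>
      consider "\<not> S i j" | "Gr i j" | "S i j" "\<not> Gr i j" by blast
      then show ?thesis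
      proof cases
        case 1
        then have "Sh < 2 * \<delta> * a" using a by (simp add: S_def dens pos_divide_less_eq not_le)
        moreover have "\<phi> i j = -2" using 1 ij by (simp add: \<phi>_def Gr_def)
        moreover have "3 * \<mu> * a \<le> p * a" using \<mu> a by (intro mult_right_mono) auto
        ultimately show ?thesis using Sb \<open>Sb + p * a - Sh \<le> Sd\<close> by (simp add: algebra_simps)
      next
        case 2
        then have "\<phi> i j = 1" using ij by (simp add: \<phi>_def Gr_def)
        moreover have "0 \<le> \<delta> * a" "0 \<le> \<tau> * a" using \<delta> \<tau> a by auto
        ultimately show ?thesis using 3 by (simp add: algebra_simps)
      next
        case 3
        then have "(1 - 2 * \<delta>) * a < Sh" using a by (simp add: Gr_def dens pos_divide_le_eq not_le less_divide_eq)
        moreover have "\<phi> i j = 0" using 3 ij by (simp add: \<phi>_def)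
        moreover have "\<mu> * a \<le> (1 - p) * a" using \<mu> a by (intro mult_right_mono) auto
        ultimately show ?thesis using Sb 2 by (simp add: algebra_simps)
      qed
    qed
    then show ?thesis using a by (simp add: dens pos_le_divide_eq)
  qed
  have "\<mu> * (\<Sum>(i, j)\<in>pairs_below k. \<phi> i j) \<le> 1 * real k"
    using \<phi> \<mu> by (meson mult_left_mono mult_right_mono of_nat_0_le_iff order_trans)
  then have "real (card (pairs_below k)) * (\<mu> - 2 * \<delta> - \<tau>) - real k
      \<le> real (card (pairs_below k)) * (\<mu> - 2 * \<delta> - \<tau>) - \<mu> * (\<Sum>(i, j)\<in>pairs_below k. \<phi> i j)" by simp
  also have "\<dots> = (\<Sum>(i, j)\<in>pairs_below k. (\<mu> - 2 * \<delta> - \<tau>) - \<mu> * \<phi> i j)"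
    by (simp add: sum_subtractf[of "\<lambda>_. \<mu> - 2 * \<delta> - \<tau>"] sum_distrib_left case_prod_unfold)
  also have "\<dots> \<le> (\<Sum>(i, j)\<in>pairs_below k. density d (X i) (X j))"
    by (intro sum_mono) (auto simp: pairs_below_def point)
  finally show ?thesis by (simp add: \<mu>_def)
qed

text \<open>Quasirandomness with both sets equal to the whole vertex set controls the number of
  edges; each edge is counted in both orders.\<close>

lemma sum_bias:
  assumes "G \<subseteq> all_pairs {..<n}"
  shows "(\<Sum>x<n. \<Sum>y<n. bias p G x y) = 2 * (real (card G) - p * real (n choose 2))"
proof -
  have "(\<Sum>(i, j)\<in>pairs_below n. of_bool ({i, j} \<in> G)) = real (card G)"
  proof -
    have "(\<Sum>(i, j)\<in>pairs_below n. of_bool ({i, j} \<in> G)) = real (card (pairs_below n \<inter> {q. {fst q, snd q} \<in> G}))"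
      by (simp add: case_prod_unfold sum_of_bool_eq)
    also have "card (pairs_below n \<inter> {q. {fst q, snd q} \<in> G}) = card G"
    proof (rule bij_betw_same_card[of "\<lambda>q. {fst q, snd q}"], rule bij_betwI')
      fix e assume "e \<in> G"
      then obtain x y where "x < n" "y < n" "x \<noteq> y" "e = {x, y}" using assms by (auto simp: all_pairs_def)
      then show "\<exists>q\<in>pairs_below n \<inter> {q. {fst q, snd q} \<in> G}. e = {fst q, snd q}"
        using \<open>e \<in> G\<close> by (intro bexI[of _ "(min x y, max x y)"]) (auto simp: pairs_below_def min_def max_def insert_commute)
    qed (auto simp: pairs_below_def doubleton_eq_iff)
    finally show ?thesis .
  qed
  moreover have "(\<Sum>(i, j)\<in>pairs_below n. bias p G i j) = (\<Sum>(i, j)\<in>pairs_below n. of_bool ({i, j} \<in> G) - p)"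
    by (intro sum.cong refl) (auto simp: pairs_below_def bias_def)
  moreover have "(\<Sum>x<n. \<Sum>y<n. bias p G x y) = 2 * (\<Sum>(i, j)\<in>pairs_below n. bias p G i j)"
    by (rule sum_pairs_below_symmetric) (rule bias_commute, simp add: bias_def)
  ultimately show ?thesis
    by (simp add: case_prod_unfold sum_subtractf card_pairs_below choose_two_real)
qed

text \<open>The constants are fixed in the order \<open>k\<close>, then \<open>\<delta>\<close>,
  \<open>\<tau>\<close>, \<open>c\<close>, then \<open>\<kappa>\<close>, then \<open>\<eta>\<close>.
  As \<open>G\<close> is chosen before \<open>H\<close>, its discrepancy must already be small on
  the scale of the subsets that regularisation will produce.\<close>

lemma exists_far_graph:
  assumes p: "0 \<le> p" "p \<le> 1" and \<epsilon>: "0 < \<epsilon>" "\<epsilon> \<le> (1::real)"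
  shows "\<exists>N. \<forall>n\<ge>N. \<exists>G\<subseteq>all_pairs {..<n}.
    \<bar>real (card G) - p * real (n choose 2)\<bar> \<le> \<epsilon> * (real n)\<^sup>2 \<and> min (p / 3) (1 - p) - \<epsilon> \<le> dist_word {..<n} G"
proof -
  define \<mu> where "\<mu> = min (p / 3) (1 - p)"
  have \<mu>: "0 \<le> \<mu>" "\<mu> \<le> 1" using p by (auto simp: \<mu>_def min_def)
  define k where "k = nat \<lceil>8 / \<epsilon>\<rceil> + 2"
  have k: "2 \<le> k" "8 / \<epsilon> < real k - 1" unfolding k_def by linarith+
  define K where "K = real (card (pairs_below k))"
  have K: "K = real k * (real k - 1) / 2" unfolding K_def by (rule card_pairs_below)
  \<comment> \<open>Since \<open>2 * \<delta> + \<tau> + c = \<epsilon> / 2\<close>, the final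
    comparison leaves \<open>K * \<epsilon> / 2 \<le> 2 * k\<close>, which the choice of
    \<open>k\<close> excludes.\<close>
  define \<delta> where "\<delta> = \<epsilon> / 16"
  define \<tau> where "\<tau> = \<epsilon> / 8"
  define c where "c = \<epsilon> / 4"
  define \<kappa> where "\<kappa> = exp (- (K + c * K) / (c * (\<delta> / 2)\<^sup>2 * \<delta>\<^sup>2 / 4))"
  \<comment> \<open>The parts have size at least \<open>\<kappa> * s\<close> with
    \<open>n \<le> 2 * k * s\<close>, so \<open>\<eta> * n\<^sup>2\<close> is at most
    \<open>\<tau>\<close> times the product of two part sizes.\<close>
  define \<eta> where "\<eta> = \<tau> * \<kappa>\<^sup>2 / (4 * (real k)\<^sup>2)"
  have pos: "0 < \<delta>" "\<delta> \<le> 1" "0 < \<tau>" "0 < c" "0 < \<kappa>" using \<epsilon> by (simp_all add: \<delta>_def \<tau>_def c_def \<kappa>_def)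
  have "0 \<le> K" unfolding K_def by simp
  then have "0 \<le> (K + c * K) / (c * (\<delta> / 2)\<^sup>2 * \<delta>\<^sup>2 / 4)"
    using pos by (intro divide_nonneg_nonneg add_nonneg_nonneg mult_nonneg_nonneg) auto
  then have \<kappa>1: "\<kappa> \<le> 1"
    unfolding \<kappa>_def exp_le_one_iff minus_divide_left[symmetric] neg_le_0_iff_le .
  have \<eta>: "0 < \<eta>" using pos k by (simp add: \<eta>_def)
  have \<eta>\<epsilon>: "\<eta> \<le> \<epsilon>"
  proof -
    have "\<tau> * \<kappa>\<^sup>2 \<le> \<tau> * 1" using pos \<kappa>1 by (intro mult_left_mono power_le_one) auto
    moreover have "1 \<le> (real k)\<^sup>2" using k by (intro one_le_power) simp
    then have "1 \<le> 4 * (real k)\<^sup>2" by linarith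
    ultimately have "\<eta> \<le> \<tau> / 1" unfolding \<eta>_def using pos by (intro frac_le) auto
    then show ?thesis using \<epsilon> by (simp add: \<tau>_def)
  qed
  obtain N where N: "\<And>n. n \<ge> N \<Longrightarrow> \<exists>G\<subseteq>all_pairs {..<n}. \<forall>A B. A \<subseteq> {..<n} \<longrightarrow> B \<subseteq> {..<n} \<longrightarrow>
      \<bar>\<Sum>x\<in>A. \<Sum>y\<in>B. bias p G x y\<bar> \<le> \<eta> * (real n)\<^sup>2"
    using exists_quasirandom_graph[OF p \<eta>] by blast
  show ?thesis
  proof (rule exI[of _ "max N (4 * k\<^sup>2)"], intro allI impI)
    fix n assume n: "max N (4 * k\<^sup>2) \<le> n"
    obtain G where G: "G \<subseteq> all_pairs {..<n}" and disc: "\<And>A B. A \<subseteq> {..<n} \<Longrightarrow> B \<subseteq> {..<n} \<Longrightarrow>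
      \<bar>\<Sum>x\<in>A. \<Sum>y\<in>B. bias p G x y\<bar> \<le> \<eta> * (real n)\<^sup>2"
      using N[of n] n by auto
    have "\<bar>real (card G) - p * real (n choose 2)\<bar> \<le> \<epsilon> * (real n)\<^sup>2"
    proof -
      have "2 * \<bar>real (card G) - p * real (n choose 2)\<bar> \<le> \<eta> * (real n)\<^sup>2"
        using disc[of "{..<n}" "{..<n}"] unfolding sum_bias[OF G] abs_mult by simp
      also have "\<dots> \<le> \<epsilon> * (real n)\<^sup>2" using \<eta>\<epsilon> by (intro mult_right_mono) auto
      finally show ?thesis by (rule order_trans[rotated]) simp
    qed
    moreover have "\<mu> - \<epsilon> \<le> dist_word {..<n} G"
    proof (rule ccontr)
      assume "\<not> ?thesis"
      then obtain H where H: "H \<subseteq> all_pairs {..<n}" "word_representable {..<n} H" "gdist {..<n} G H < \<mu> - \<epsilon>"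
        using dist_word_attained[of "{..<n}" G] by (metis finite_lessThan not_le)
      define D where "D = G - H \<union> (H - G)"
      have finD: "finite D" unfolding D_def
        using G H(1) by (auto intro: finite_subset[OF _ finite_all_pairs[OF finite_lessThan]])
      define s where "s = n div k"
      have n4: "4 * k\<^sup>2 \<le> n" using n by simp
      note ib = interval_bounds[OF k(1) n4, folded s_def]
      have "1 \<le> k\<^sup>2" using k by (intro one_le_power) simp
      then have "2 \<le> n" using n4 by linarith
      then have n0: "0 < real (n choose 2)" by simp
      have cardD: "real (card D) \<le> (\<mu> - \<epsilon>) * real (n choose 2)"
        using H(3) n0 by (simp add: gdist_def D_def divide_less_eq)
      \<comment> \<open>Needed as a nonnegative factor below. It follows from the assumed
        \<open>H\<close>, a distance being nonnegative.\<close>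
      have m0: "0 \<le> \<mu> - \<epsilon>"
      proof -
        have "0 \<le> gdist {..<n} G H" by (simp add: gdist_def)
        then show ?thesis using H(3) by linarith
      qed
      obtain pos :: "nat \<Rightarrow> nat" where inj: "inj_on pos {..<n}"
        and order: "\<forall>a\<in>{..<n}. \<forall>b\<in>{..<n}. \<forall>c\<in>{..<n}. \<forall>d\<in>{..<n}.
         pos a < pos b \<longrightarrow> pos b < pos c \<longrightarrow> pos c < pos d \<longrightarrow>
         {a, b} \<in> H \<longrightarrow> {b, c} \<in> H \<longrightarrow> {c, d} \<in> H \<longrightarrow> {a, d} \<in> H \<longrightarrow> {a, c} \<in> H \<and> {b, d} \<in> H"
        by (rule word_representable_ordering[OF H(2)])
      obtain I where I': "\<forall>i<k. I i \<subseteq> {..<n} \<and> card (I i) = s"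
        and Ipos': "\<forall>i j. \<forall>x\<in>I i. \<forall>y\<in>I j. i < j \<longrightarrow> j < k \<longrightarrow> pos x < pos y"
        by (rule ordered_intervals[OF inj ib(4,3)])
      note I = I'[rule_format]
      have Ipos: "pos x < pos y" if "i < j" "j < k" "x \<in> I i" "y \<in> I j" for i j x y
        using Ipos' that by blast
      have finI: "finite (I i) \<and> I i \<noteq> {}" if "i < k" for i
        using I[OF that] ib(3) by (auto intro: finite_subset)
      then have finI_all: "\<forall>i<k. finite (I i) \<and> I i \<noteq> {}" by blast
      define h where "h = (\<lambda>x y. of_bool ({x, y} \<in> H) :: real)"
      define d where "d = (\<lambda>x y. of_bool ({x, y} \<in> G - H \<union> (H - G)) :: real)"
      have h: "0 \<le> h x y \<and> h x y \<le> 1" and d: "0 \<le> d x y \<and> d x y \<le> 1" for x y by (simp_all add: h_def d_def)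
      obtain X where X': "\<forall>i<k. X i \<subseteq> I i \<and> X i \<noteq> {} \<and> \<kappa> * card (I i) \<le> card (X i)"
        and Xsum: "(\<Sum>(i, j)\<in>pairs_below k. density d (X i) (X j)) \<le> (\<Sum>(i, j)\<in>pairs_below k. density d (I i) (I j)) + c * K"
        and Xreg: "\<forall>i j A B. i < j \<longrightarrow> j < k \<longrightarrow> A \<subseteq> X i \<longrightarrow> B \<subseteq> X j \<longrightarrow> \<delta> / 2 * card (X i) \<le> card A \<longrightarrow>
          \<delta> / 2 * card (X j) \<le> card B \<longrightarrow> \<bar>density h A B - density h (X i) (X j)\<bar> < \<delta>"
        using regular_subtuple[of k I d h c "\<delta> / 2" \<delta>, OF finI_all d h pos(4) half_gt_zero[OF pos(1)] pos(1)]
        unfolding K_def[symmetric] \<kappa>_def[symmetric]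
        by (elim exE conjE) (rule that)
      note X = X'[rule_format]
      have finX: "finite (X i) \<and> X i \<noteq> {}" if "i < k" for i
        using X[OF that] finI[OF that] finite_subset by blast
      have lower: "K * (\<mu> - 2 * \<delta> - \<tau>) - real k \<le> (\<Sum>(i, j)\<in>pairs_below k. density d (X i) (X j))"
        unfolding K_def \<mu>_def
      proof (rule regular_tuple_cost[OF p pos(1,2) less_imp_le[OF pos(3)] finX _ _ h_def d_def Xreg[rule_format]])
        show "pos x < pos y" if "i < j" "j < k" "x \<in> X i" "y \<in> X j" for i j x y
          using Ipos[OF that(1,2), of x y] X[of i] X[of j] that by (meson order.strict_trans subsetD)
        have U: "\<Union>(X ` {..<k}) \<subseteq> {..<n}" using X I by blast
        show "{a, b'} \<in> H \<and> {b, d'} \<in> H"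
          if "a \<in> \<Union>(X ` {..<k})" "b \<in> \<Union>(X ` {..<k})" "b' \<in> \<Union>(X ` {..<k})" "d' \<in> \<Union>(X ` {..<k})"
            "pos a < pos b" "pos b < pos b'" "pos b' < pos d'" "{a, b} \<in> H" "{b, b'} \<in> H" "{b', d'} \<in> H" "{a, d'} \<in> H"
          for a b b' d'
        proof -
          have "a \<in> {..<n}" "b \<in> {..<n}" "b' \<in> {..<n}" "d' \<in> {..<n}" using that(1-4) U by blast+
          then show ?thesis using that(5-11) by (rule order[rule_format])
        qed
        show "\<bar>\<Sum>x\<in>X i. \<Sum>y\<in>X j. bias p G x y\<bar> \<le> \<tau> * (card (X i) * card (X j))" if ij: "i < j" "j < k" for i j
        proof -
          have "i < k" using ij by simp
          have sub: "X i \<subseteq> {..<n}" "X j \<subseteq> {..<n}" using X I ij \<open>i < k\<close> by blast+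
          have big: "\<kappa> * real s \<le> card (X l)" if "l < k" for l using X[OF that] I[OF that] by auto
          have "\<eta> * (real n)\<^sup>2 \<le> \<eta> * (2 * real k * real s)\<^sup>2"
            using \<eta> ib(1) by (intro mult_left_mono power_mono) auto
          also have "\<dots> = \<tau> * ((\<kappa> * real s) * (\<kappa> * real s))"
            using k by (simp add: \<eta>_def power2_eq_square)
          also have "\<dots> \<le> \<tau> * (card (X i) * card (X j))"
            unfolding of_nat_mult using pos big[OF \<open>i < k\<close>] big[OF ij(2)] by (intro mult_left_mono mult_mono) auto
          finally show ?thesis using disc[OF sub] by linarith
        qed
      qed
      \<comment> \<open>Edits inside an interval or at leftover vertices are ignored. Bounding
        \<open>n\<^sup>2 / 2\<close> by \<open>(K + k) * s\<^sup>2\<close> costs at most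
        \<open>k\<close>.\<close>
      have start: "(\<Sum>(i, j)\<in>pairs_below k. density d (I i) (I j)) \<le> (\<mu> - \<epsilon>) * K + real k"
      proof -
        have s2: "0 < (real s)\<^sup>2" using ib(3) by simp
        have "(\<Sum>(i, j)\<in>pairs_below k. density d (I i) (I j)) =
          (\<Sum>(i, j)\<in>pairs_below k. (\<Sum>x\<in>I i. \<Sum>y\<in>I j. d x y) / (real s)\<^sup>2)"
          by (intro sum.cong refl) (auto simp: pairs_below_def density_def I power2_eq_square)
        also have "\<dots> = (\<Sum>(i, j)\<in>pairs_below k. \<Sum>x\<in>I i. \<Sum>y\<in>I j. d x y) / (real s)\<^sup>2"
          by (simp add: sum_divide_distrib case_prod_unfold)
        also have "\<dots> \<le> real (card D) / (real s)\<^sup>2"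
          unfolding d_def D_def[symmetric]
          using finI Ipos by (intro divide_right_mono sum_cross_edges_le[OF finD, where pos = pos]) auto
        also have "\<dots> \<le> (\<mu> - \<epsilon>) * ((real n)\<^sup>2 / 2) / (real s)\<^sup>2"
        proof (intro divide_right_mono)
          have "real (n choose 2) \<le> (real n)\<^sup>2 / 2" by (simp add: choose_two_real power2_eq_square algebra_simps)
          then show "real (card D) \<le> (\<mu> - \<epsilon>) * ((real n)\<^sup>2 / 2)"
            using cardD m0 by (meson mult_left_mono order_trans)
        qed simp
        also have "\<dots> \<le> (\<mu> - \<epsilon>) * ((real k ^ 2 + real k) * (real s)\<^sup>2 / 2) / (real s)\<^sup>2"
          using ib(2) m0 by (intro divide_right_mono mult_left_mono) auto
        also have "\<dots> = (\<mu> - \<epsilon>) * K + (\<mu> - \<epsilon>) * real k"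
        proof -
          have "(\<mu> - \<epsilon>) * ((real k ^ 2 + real k) * (real s)\<^sup>2 / 2) / (real s)\<^sup>2 = (\<mu> - \<epsilon>) * ((real k ^ 2 + real k) / 2)"
            using s2 by simp
          also have "(real k ^ 2 + real k) / 2 = K + real k" by (simp add: K power2_eq_square field_simps)
          finally show ?thesis by (simp add: distrib_left)
        qed
        also have "(\<mu> - \<epsilon>) * real k \<le> 1 * real k" using \<mu> \<epsilon> by (intro mult_right_mono) auto
        finally show ?thesis by simp
      qed
      have "K * (\<mu> - 2 * \<delta> - \<tau>) - real k \<le> (\<mu> - \<epsilon>) * K + real k + c * K"
        using lower Xsum start by linarith
      then have "K * \<epsilon> \<le> 4 * real k"
        by (simp add: \<delta>_def \<tau>_def c_def algebra_simps)
      then have "(real k * ((real k - 1) * \<epsilon>)) \<le> real k * 8" by (simp add: K)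
      then have "(real k - 1) * \<epsilon> \<le> 8" using k(1) by simp
      then show False using k(2) \<epsilon> by (simp add: divide_less_eq)
    qed
    ultimately show "\<exists>G\<subseteq>all_pairs {..<n}. \<bar>real (card G) - p * real (n choose 2)\<bar> \<le> \<epsilon> * (real n)\<^sup>2 \<and>
        min (p / 3) (1 - p) - \<epsilon> \<le> dist_word {..<n} G"
      using G unfolding \<mu>_def by blast
  qed
qed

section \<open>The edit distance function\<close>

lemma finite_dist_words:
  fixes n :: nat
  shows "finite {dist_word {..<n} E | E. E \<subseteq> all_pairs {..<n} \<and> P E}"
  by (rule finite_subset[of _ "dist_word {..<n} ` Pow (all_pairs {..<n})"]) auto

lemma nat_floor_mult_le:
  assumes "0 \<le> p" "p \<le> (1::real)"
  shows "nat \<lfloor>p * real m\<rfloor> \<le> m"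
proof -
  have "p * real m \<le> real m" using assms by (simp add: mult_left_le_one_le)
  then show ?thesis by linarith
qed

text \<open>The quasirandom graph has only approximately the prescribed number of edges; this
  corrects it to the exact number with as few edits as possible.\<close>

lemma edit_to_card:
  assumes "finite P" "G \<subseteq> P" "m \<le> card P"
  obtains G' where "G' \<subseteq> P" "card G' = m" "real (card (G' - G \<union> (G - G'))) = \<bar>real (card G) - real m\<bar>"
proof (cases "m \<le> card G")
  case True
  have fin: "finite G" using assms finite_subset by blast
  obtain G' where "G' \<subseteq> G" "card G' = m" using obtain_subset_with_card_n[OF True] by blast
  then have "G' \<subseteq> P" "G' - G \<union> (G - G') = G - G'" "finite G'" using assms fin finite_subset by auto
  with \<open>G' \<subseteq> G\<close> \<open>card G' = m\<close> True show thesis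
    by (intro that[of G']) (simp_all add: card_Diff_subset of_nat_diff)
next
  case False
  have fin: "finite G" using assms finite_subset by blast
  have "m - card G \<le> card (P - G)" using assms fin by (simp add: card_Diff_subset)
  then obtain F where F: "F \<subseteq> P - G" "card F = m - card G" "finite F" using obtain_subset_with_card_n by blast
  have disj: "G \<inter> F = {}" using F by blast
  then have "card (G \<union> F) = m" using fin F False by (simp add: card_Un_disjoint)
  moreover have "G \<union> F - G \<union> (G - (G \<union> F)) = F" using disj by blast
  ultimately show thesis using that[of "G \<union> F"] F assms False by (auto simp: of_nat_diff)
qed

text \<open>Rounding the edge count down can only help the bound by a third of the edges; in the
  complement bound it costs at most one edge, hence the extra term.\<close>

lemma ed_max_le:
  assumes p: "0 \<le> p" "p \<le> 1" and n: "n \<ge> 2"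
  shows "ed_max p n \<le> min (p / 3) (1 - p) + 1 / real (n choose 2)"
proof -
  define m where "m = nat \<lfloor>p * real (n choose 2)\<rfloor>"
  have N: "real (n choose 2) > 0" using n by simp
  have "m \<le> n choose 2"
    unfolding m_def using p by (rule nat_floor_mult_le)
  then obtain E where "E \<subseteq> all_pairs {..<n}" "card E = m"
    using obtain_subset_with_card_n[of m "all_pairs {..<n}"] by (auto simp: card_all_pairs)
  then have ne: "{dist_word {..<n} E | E. E \<subseteq> all_pairs {..<n} \<and> card E = m} \<noteq> {}" by blast
  have m: "real m \<le> p * real (n choose 2)" "p * real (n choose 2) - 1 \<le> real m"
    using p N unfolding m_def by (auto simp: of_nat_nat)
  have "dist_word {..<n} E \<le> min (p / 3) (1 - p) + 1 / real (n choose 2)"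
    if E: "E \<subseteq> all_pairs {..<n}" "card E = m" for E
  proof -
    have "real m / real (n choose 2) \<le> p" using m N by (simp add: divide_le_eq)
    then have "dist_word {..<n} E \<le> p / 3"
      using dist_word_le_third[of "{..<n}" E] E by simp
    moreover have "p - 1 / real (n choose 2) \<le> real m / real (n choose 2)"
      using divide_right_mono[OF m(2), of "real (n choose 2)"] N by (simp add: diff_divide_distrib)
    then have "dist_word {..<n} E \<le> 1 - p + 1 / real (n choose 2)"
      using dist_word_le_complement[of "{..<n}" E] E n by simp
    ultimately show ?thesis using N by (simp add: min_def add_increasing2)
  qed
  then show ?thesis unfolding ed_max_def m_def[symmetric] using ne finite_dist_words by (subst Max_le_iff) auto
qed

text \<open>Of the \<open>6 * \<epsilon>\<close>, one comes from \<open>exists_far_graph\<close> and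
  five from correcting the edge count: \<open>n\<^sup>2\<close> is at most four times the number
  \<open>C\<close> of pairs, and the rounding error 1 is at most
  \<open>\<epsilon> * C\<close>.\<close>

lemma ed_max_ge:
  assumes p: "0 \<le> p" "p \<le> 1" and \<epsilon>: "0 < \<epsilon>" "\<epsilon> \<le> 1"
  shows "\<exists>N. \<forall>n\<ge>N. min (p / 3) (1 - p) - 6 * \<epsilon> \<le> ed_max p n"
proof -
  obtain N where N: "\<And>n. n \<ge> N \<Longrightarrow> \<exists>G\<subseteq>all_pairs {..<n}.
    \<bar>real (card G) - p * real (n choose 2)\<bar> \<le> \<epsilon> * (real n)\<^sup>2 \<and> min (p / 3) (1 - p) - \<epsilon> \<le> dist_word {..<n} G"
    using exists_far_graph[OF p \<epsilon>] by blast
  show ?thesis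
  proof (rule exI[of _ "max N (nat \<lceil>2 / \<epsilon>\<rceil> + 2)"], intro allI impI)
    fix n assume n: "max N (nat \<lceil>2 / \<epsilon>\<rceil> + 2) \<le> n"
    then have n2: "n \<ge> 2" and n\<epsilon>: "2 / \<epsilon> \<le> real n - 1" by linarith+
    obtain G where G: "G \<subseteq> all_pairs {..<n}" "\<bar>real (card G) - p * real (n choose 2)\<bar> \<le> \<epsilon> * (real n)\<^sup>2"
      "min (p / 3) (1 - p) - \<epsilon> \<le> dist_word {..<n} G"
      using N[of n] n by auto
    define C where "C = real (n choose 2)"
    have C0: "C > 0" using n2 by (simp add: C_def)
    have C: "C = real n * (real n - 1) / 2" by (simp add: C_def choose_two_real)
    have n2C: "(real n)\<^sup>2 \<le> 4 * C"
    proof -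
      have "real n * real n \<le> real n * (2 * (real n - 1))" using n2 by (intro mult_left_mono) auto
      then show ?thesis by (simp add: C power2_eq_square algebra_simps)
    qed
    have C1: "1 \<le> \<epsilon> * C"
    proof -
      have "2 \<le> \<epsilon> * (real n - 1)" using n\<epsilon> \<epsilon> by (simp add: field_simps)
      moreover have "1 * (\<epsilon> * (real n - 1)) \<le> real n * (\<epsilon> * (real n - 1))"
        using n2 \<epsilon> by (intro mult_right_mono mult_nonneg_nonneg) auto
      moreover have "real n * (\<epsilon> * (real n - 1)) = 2 * (\<epsilon> * C)" by (simp add: C)
      ultimately show ?thesis by linarith
    qed
    define m where "m = nat \<lfloor>p * C\<rfloor>"
    have pC: "0 \<le> p * C" "p * C \<le> C" using p C0 by (auto simp: mult_left_le_one_le)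
    then have m: "real m \<le> p * C" "p * C - 1 \<le> real m" unfolding m_def by linarith+
    then have "m \<le> n choose 2" using pC unfolding C_def by linarith
    then have "m \<le> card (all_pairs {..<n})" by (simp add: card_all_pairs)
    then obtain G' where G': "G' \<subseteq> all_pairs {..<n}" "card G' = m"
      "real (card (G' - G \<union> (G - G'))) = \<bar>real (card G) - real m\<bar>"
      using edit_to_card[OF finite_all_pairs[OF finite_lessThan] G(1)] by blast
    have "real (card (G' - G \<union> (G - G'))) \<le> \<epsilon> * (real n)\<^sup>2 + 1"
      using G' G(2) m unfolding C_def by linarith
    also have "\<dots> \<le> \<epsilon> * (4 * C) + \<epsilon> * C" using n2C C1 \<epsilon> by (intro add_mono mult_left_mono) auto
    finally have "gdist {..<n} G G' \<le> 5 * \<epsilon>"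
      using C0 by (simp add: gdist_def C_def[symmetric] Un_commute divide_le_eq algebra_simps)
    then have "min (p / 3) (1 - p) - 6 * \<epsilon> \<le> dist_word {..<n} G'"
      using dist_word_edit[of "{..<n}" G G'] G G' by simp
    also have "\<dots> \<le> ed_max p n" unfolding ed_max_def
      using G' by (intro Max_ge finite_dist_words) (auto simp: m_def C_def)
    finally show "min (p / 3) (1 - p) - 6 * \<epsilon> \<le> ed_max p n" .
  qed
qed

lemma ed_max_le_dist_max:
  assumes "0 \<le> p" "p \<le> 1"
  shows "ed_max p n \<le> dist_max n"
proof -
  have "nat \<lfloor>p * real (n choose 2)\<rfloor> \<le> n choose 2"
    using assms by (rule nat_floor_mult_le)
  then obtain E where "E \<subseteq> all_pairs {..<n}" "card E = nat \<lfloor>p * real (n choose 2)\<rfloor>"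
    using obtain_subset_with_card_n[of _ "all_pairs {..<n}"] by (metis card_all_pairs finite_lessThan card_lessThan)
  then show ?thesis unfolding ed_max_def dist_max_def
    using finite_dist_words[of n "\<lambda>_. True"] by (intro Max_mono) auto
qed

text \<open>The bounds \<open>x / 3\<close> and \<open>1 - x\<close> cross at density
  \<open>x = 3 / 4\<close>.\<close>

lemma dist_max_le:
  assumes "n \<ge> 2"
  shows "dist_max n \<le> 1 / 4"
proof -
  have "dist_word {..<n} E \<le> 1 / 4" if "E \<subseteq> all_pairs {..<n}" for E
    using dist_word_le_third[of "{..<n}" E] dist_word_le_complement[of "{..<n}" E] that assms by simp
  then show ?thesis unfolding dist_max_def
    using finite_dist_words[of n "\<lambda>_. True"] by (subst Max_le_iff) auto
qed

lemma tendsto_choose_two_inverse: "(\<lambda>n. 1 / real (n choose 2)) \<longlonglongrightarrow> 0"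
proof (rule tendsto_sandwich[where f = "\<lambda>_. 0"])
  show "\<forall>\<^sub>F n in sequentially. 1 / real (n choose 2) \<le> 2 / real n"
  proof (rule eventually_sequentiallyI[of 2])
    fix n :: nat assume n: "2 \<le> n"
    have "real n * 1 \<le> real n * (real n - 1)" using n by (intro mult_left_mono) auto
    then have "real n / 2 \<le> real (n choose 2)" by (simp add: choose_two_real)
    then have "1 / real (n choose 2) \<le> 1 / (real n / 2)" using n by (intro divide_left_mono) auto
    then show "1 / real (n choose 2) \<le> 2 / real n" by simp
  qed
  show "(\<lambda>n. 2 / real n) \<longlonglongrightarrow> 0" by (rule lim_const_over_n)
qed auto

lemma ed_max_tendsto:
  assumes p: "0 \<le> p" "p \<le> 1"
  shows "ed_max p \<longlonglongrightarrow> min (p / 3) (1 - p)"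
proof (rule order_tendstoI)
  fix a assume a: "a < min (p / 3) (1 - p)"
  define \<epsilon> where "\<epsilon> = min 1 ((min (p / 3) (1 - p) - a) / 12)"
  have \<epsilon>: "0 < \<epsilon>" "\<epsilon> \<le> 1" "12 * \<epsilon> \<le> min (p / 3) (1 - p) - a" using a by (auto simp: \<epsilon>_def min_def)
  obtain N where N: "\<And>n. n \<ge> N \<Longrightarrow> min (p / 3) (1 - p) - 6 * \<epsilon> \<le> ed_max p n"
    using ed_max_ge[OF p \<epsilon>(1,2)] by blast
  show "\<forall>\<^sub>F n in sequentially. a < ed_max p n"
    using N \<epsilon> by (intro eventually_sequentiallyI[of N]) (smt (verit))
next
  fix a assume a: "min (p / 3) (1 - p) < a"
  have "\<forall>\<^sub>F n in sequentially. 1 / real (n choose 2) < a - min (p / 3) (1 - p)"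
    using order_tendstoD(2)[OF tendsto_choose_two_inverse] a by simp
  then show "\<forall>\<^sub>F n in sequentially. ed_max p n < a"
    using eventually_ge_at_top[of 2]
  proof eventually_elim
    case (elim n)
    then show ?case using ed_max_le[OF p elim(2)] by linarith
  qed
qed

lemma dist_max_tendsto: "dist_max \<longlonglongrightarrow> 1 / 4"
proof (rule tendsto_sandwich)
  show "ed_max (3 / 4) \<longlonglongrightarrow> 1 / 4" using ed_max_tendsto[of "3 / 4"] by simp
  show "\<forall>\<^sub>F n in sequentially. ed_max (3 / 4) n \<le> dist_max n"
    by (intro always_eventually allI ed_max_le_dist_max) auto
  show "\<forall>\<^sub>F n in sequentially. dist_max n \<le> 1 / 4"
    by (rule eventually_sequentiallyI[of 2]) (rule dist_max_le)
qed simp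

theorem mainTheorem1:
  shows "(\<forall>p::real. 0 \<le> p \<and> p \<le> 1 \<longrightarrow> ed_max p \<longlonglongrightarrow> min (p / 3) (1 - p))
    \<and> dist_max \<longlonglongrightarrow> 1 / 4
    \<and> (\<forall>(\<epsilon>::real) (V::'a set) E. \<epsilon> > 0 \<and> finite V \<and> card V \<ge> 2 \<and> E \<subseteq> all_pairs V
          \<and> dist_word V E \<ge> 1 / 4 - \<epsilon> \<longrightarrow>
          3 / 4 - 3 * \<epsilon> \<le> real (card E) / real (card V choose 2) \<and>
          real (card E) / real (card V choose 2) \<le> 3 / 4 + \<epsilon>)"
proof (intro conjI allI impI)
  show "ed_max p \<longlonglongrightarrow> min (p / 3) (1 - p)" if "0 \<le> p \<and> p \<le> 1" for p
    using ed_max_tendsto that by blast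
  show "dist_max \<longlonglongrightarrow> 1 / 4" by (rule dist_max_tendsto)
  fix \<epsilon> :: real and V :: "'a set" and E
  assume "\<epsilon> > 0 \<and> finite V \<and> card V \<ge> 2 \<and> E \<subseteq> all_pairs V \<and> dist_word V E \<ge> 1 / 4 - \<epsilon>"
  then have V: "finite V" "E \<subseteq> all_pairs V" "card V \<ge> 2" and dist: "dist_word V E \<ge> 1 / 4 - \<epsilon>" by auto
  \<comment> \<open>Stability: the two upper bounds on the distance, solved for the edge
    density.\<close>
  show "3 / 4 - 3 * \<epsilon> \<le> real (card E) / real (card V choose 2)"
    using order_trans[OF dist dist_word_le_third[OF V(1,2)]] by simp
  show "real (card E) / real (card V choose 2) \<le> 3 / 4 + \<epsilon>"
    using dist_word_le_complement[OF V] dist by linarith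
qed

end
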